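(* Let $\kappa>0$ and let $j_1>0$ be small. Consider, on the reduced space $w_1^2+w_2^2=8(\pi_3^2-j_1^2)(\pi_3-j_1)$, $-j_1\le\pi_3\le j_1$, of the drift system (see context), the motion along the intersection with the plane $w_2=h$, $h\ne0$ small, that is, along the closed curve $$w_1^2+h^2=8(\pi_3^2-j_1^2)(\pi_3-j_1),\qquad r_1\le\pi_3\le r_2,$$ where $r_1(h)<r_2(h)<r_3(h)$ are the roots of the cubic $8(\pi_3-j_1)^2(\pi_3+j_1)-h^2$. Let $\theta$ be the $S^1$ reconstruction phase, i.e. the counterclockwise angle of the vector $(\pi_1(t),\pi_2(t))$ from the axis $\pi_2=0$, governed along this curve by $$\frac{d\theta}{d\pi_3}=\frac{-h\pi_3}{(j_1^2-\pi_3^2)w_1},\qquad\frac{d\pi_3}{dt}=-\frac{\kappa w_1}{2},$$ and let $\phi(h)$ be the total change of $\theta$ over one traversal of the closed curve, from $(w_1,\pi_3)=(0,r_2)$ to $(0,r_1)$ (with $w_1>0$) and back to $(0,r_2)$ (with $w_1<0$). Then $$\phi(h)=-2\int_{r_1}^{r_2}\frac{-h\pi_3}{(j_1^2-\pi_3^2)\sqrt{8(\pi_3-r_1)(r_2-\pi_3)(r_3-\pi_3)}}\,d\pi_3 .$$ As $h\to0^+$ the part of this integral over $[r_1,0]$ tends to $\pi/2$ and the part over $[0,r_2]$ (the end at the singularity of the reduced space) tends to $-\pi/4$, while as $h\to0^-$ these parts tend to $-\pi/2$ and $\pi/4$. Hence, as the homoclinic orbit $w_2=0$ is approached, $$\lim_{h\to0^+}\phi(h)=-2\left(\frac\pi2-\frac\pi4\right)=-\frac\pi2,\qquad\lim_{h\to0^-}\phi(h)=\frac\pi2,$$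 so the $S^1$ reconstruction phase jumps by $\pi$ as the homoclinic orbit is traversed.
   Context: The drift system is the Hamiltonian system on $\mathbb R^2\times T^*SO(3)=\{(x,A,\pi)\}$ with Hamiltonian $\frac12I_1(\pi_1^2+\pi_2^2)+\frac12I_2\pi_3^2+\kappa(\pi_1x_1+\pi_2x_2)+a\pi_3$, where $a$ is a constant and $I_1=I_2$; after reduction by $SO(3)$ its equations on $\mathbb R^2\times\mathbb R^3=\{(x,\pi)\}$ are $\dot\pi_1=-\kappa x_2\pi_3+a\pi_2$, $\dot\pi_2=\kappa x_1\pi_3-a\pi_1$, $\dot\pi_3=\kappa(\pi_1x_2-\pi_2x_1)$, $\dot x_1=\kappa\pi_2$, $\dot x_2=-\kappa\pi_1$. It is invariant under the $S^1$ action rotating $x$ and $(\pi_1,\pi_2)$ simultaneously counterclockwise. With $w_1=2(x_1\pi_2-x_2\pi_1)$ and $w_2=2(x_1\pi_1+x_2\pi_2)$, the quotient by $S^1$ of the level set $|\pi|=j_1$, $-\frac12|x|^2-\pi_3=-j_1$ is the surface $w_1^2+w_2^2=8(\pi_3^2-j_1^2)(\pi_3-j_1)$, $-j_1\le\pi_3\le j_1$, in $\mathbb R^3=\{(w_1,w_2,\pi_3)\}$; it has a conical singularity at $(0,0,j_1)$, occupied by an unstable equilibrium, and the homoclinic orbit is the intersection of the surface with the plane $w_2=0$. The phase $\theta$ is measured relative to the lift of the curve $w_2=h$ to the level set given by $\pi_1^2+\pi_3^2=j_1^2$, $\pi_2=0$, $x_1=h/(2\pi_1)$, $x_2=-w_1/(2\pi_1)$.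 *)

theory Defs
  imports "HOL-Analysis.Analysis"
begin

text \<open>
  Points \<open>(x, \<pi>)\<close> of \<open>\<real>\<^sup>2 \<times> \<real>\<^sup>3\<close>.  The moments of inertia do not
  occur in the equations: for \<open>I\<^sub>1 = I\<^sub>2\<close> the kinetic energy is a function of the Casimir
  \<open>|\<pi>|\<^sup>2\<close>.
\<close>

type_synonym state = "(real ^ 2) \<times> (real ^ 3)"

definition drift_field :: "real \<Rightarrow> real \<Rightarrow> state \<Rightarrow> state" where
  "drift_field \<kappa> a = (\<lambda>(x, \<pi>).
     (vector [\<kappa> * \<pi>$2, - \<kappa> * \<pi>$1],
      vector [- \<kappa> * x$2 * \<pi>$3 + a * \<pi>$2,
              \<kappa> * x$1 * \<pi>$3 - a * \<pi>$1,
              \<kappa> * (\<pi>$1 * x$2 - \<pi>$2 * x$1)]))"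

definition rotate_state :: "real \<Rightarrow> state \<Rightarrow> state" where
  "rotate_state \<theta> = (\<lambda>(x, \<pi>).
     (vector [cos \<theta> * x$1 - sin \<theta> * x$2, sin \<theta> * x$1 + cos \<theta> * x$2],
      vector [cos \<theta> * \<pi>$1 - sin \<theta> * \<pi>$2, sin \<theta> * \<pi>$1 + cos \<theta> * \<pi>$2, \<pi>$3]))"

definition level_set :: "real \<Rightarrow> state set" where
  "level_set j = {(x, \<pi>). norm \<pi> = j \<and> - (1 / 2) * (norm x)\<^sup>2 - \<pi>$3 = - j}"

definition w1 :: "state \<Rightarrow> real" where
  "w1 = (\<lambda>(x, \<pi>). 2 * (x$1 * \<pi>$2 - x$2 * \<pi>$1))"

definition w2 :: "state \<Rightarrow> real" where
  "w2 = (\<lambda>(x, \<pi>). 2 * (x$1 * \<pi>$1 + x$2 * \<pi>$2))"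

definition pi3 :: "state \<Rightarrow> real" where
  "pi3 = (\<lambda>(x, \<pi>). \<pi>$3)"

text \<open>Coordinates \<open>(w\<^sub>1, w\<^sub>2, \<pi>\<^sub>3)\<close>.\<close>

definition reduced_space :: "real \<Rightarrow> (real \<times> real \<times> real) set" where
  "reduced_space j =
     {(w, v, p). w\<^sup>2 + v\<^sup>2 = 8 * (p\<^sup>2 - j\<^sup>2) * (p - j) \<and> - j \<le> p \<and> p \<le> j}"

text \<open>
  The reference lift of the curve \<open>w\<^sub>2 = h\<close>, with \<open>\<pi>\<^sub>2 = 0\<close> and the branch
  \<open>\<pi>\<^sub>1 > 0\<close> of \<open>\<pi>\<^sub>1\<^sup>2 + \<pi>\<^sub>3\<^sup>2 = j\<^sup>2\<close>.  The other branch is its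
  rotation by a half turn, so changes of the phase do not depend on this choice.
\<close>

definition lift :: "real \<Rightarrow> real \<Rightarrow> real \<Rightarrow> real \<Rightarrow> state" where
  "lift j h w p = (let q = sqrt (j\<^sup>2 - p\<^sup>2) in
     (vector [h / (2 * q), - w / (2 * q)], vector [q, 0, p]))"

definition one_traversal ::
  "real \<Rightarrow> real \<Rightarrow> real \<Rightarrow> real \<Rightarrow> real \<Rightarrow> (real \<Rightarrow> real) \<Rightarrow> (real \<Rightarrow> real) \<Rightarrow> bool"
where
  "one_traversal r1 r2 t0 t1 t2 w p \<longleftrightarrow>
     t0 < t1 \<and> t1 < t2 \<and>
     (w t0, p t0) = (0, r2) \<and> (w t1, p t1) = (0, r1) \<and> (w t2, p t2) = (0, r2) \<and>
     (\<forall>t\<in>{t0<..<t1}. w t > 0) \<and> (\<forall>t\<in>{t1<..<t2}. w t < 0)"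

text \<open>
  One traversal of the closed curve together with the phase.  The equation for
  \<open>d\<theta>/d\<pi>\<^sub>3\<close> is singular at the turning points \<open>w\<^sub>1 = 0\<close>; it is imposed in the form
  \<open>d\<theta>/dt = (d\<theta>/d\<pi>\<^sub>3) (d\<pi>\<^sub>3/dt)\<close> away from them, and \<open>\<theta>\<close> is
  continuous throughout.
\<close>

definition phase_traversal ::
  "real \<Rightarrow> real \<Rightarrow> real \<Rightarrow> real \<Rightarrow> real \<Rightarrow> real \<Rightarrow> real \<Rightarrow> real \<Rightarrow>
   (real \<Rightarrow> real) \<Rightarrow> (real \<Rightarrow> real) \<Rightarrow> (real \<Rightarrow> real) \<Rightarrow> bool"
where
  "phase_traversal \<kappa> j h r1 r2 t0 t1 t2 w p \<theta> \<longleftrightarrow>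
     one_traversal r1 r2 t0 t1 t2 w p \<and>
     (\<forall>t\<in>{t0..t2}. (w t, h, p t) \<in> reduced_space j) \<and>
     (\<forall>t\<in>{t0..t2}. (p has_real_derivative - (\<kappa> * w t / 2)) (at t within {t0..t2})) \<and>
     continuous_on {t0..t2} \<theta> \<and>
     (\<forall>t\<in>{t0..t2}. w t \<noteq> 0 \<longrightarrow>
        (\<theta> has_real_derivative
           (- h * p t / ((j\<^sup>2 - (p t)\<^sup>2) * w t)) * (- (\<kappa> * w t / 2)))
        (at t within {t0..t2}))"

text \<open>
  A motion of the drift system on the level set, along \<open>w\<^sub>2 = h\<close>, with \<open>\<theta>\<close> a
  continuous angle of \<open>(\<pi>\<^sub>1, \<pi>\<^sub>2)\<close>, measured by rotating the reference lift.
  Along solutions \<open>dw\<^sub>2/dt = a w\<^sub>1\<close>, so such motions exist only for \<open>a = 0\<close>.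
\<close>

definition drift_traversal ::
  "real \<Rightarrow> real \<Rightarrow> real \<Rightarrow> real \<Rightarrow> real \<Rightarrow> real \<Rightarrow> real \<Rightarrow> real \<Rightarrow> real \<Rightarrow>
   (real \<Rightarrow> state) \<Rightarrow> (real \<Rightarrow> real) \<Rightarrow> bool"
where
  "drift_traversal \<kappa> a j h r1 r2 t0 t1 t2 \<gamma> \<theta> \<longleftrightarrow>
     one_traversal r1 r2 t0 t1 t2 (w1 \<circ> \<gamma>) (pi3 \<circ> \<gamma>) \<and>
     (\<forall>t\<in>{t0..t2}. \<gamma> t \<in> level_set j \<and> w2 (\<gamma> t) = h) \<and>
     (\<forall>t\<in>{t0..t2}. (\<gamma> has_vector_derivative drift_field \<kappa> a (\<gamma> t)) (at t within {t0..t2})) \<and>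
     continuous_on {t0..t2} \<theta> \<and>
     (\<forall>t\<in>{t0..t2}. \<gamma> t = rotate_state (\<theta> t) (lift j h (w1 (\<gamma> t)) (pi3 (\<gamma> t))))"

definition phase_integrand ::
  "real \<Rightarrow> real \<Rightarrow> real \<Rightarrow> real \<Rightarrow> real \<Rightarrow> real \<Rightarrow> real"
where
  "phase_integrand j h r1 r2 r3 p =
     - h * p / ((j\<^sup>2 - p\<^sup>2) * sqrt (8 * (p - r1) * (r2 - p) * (r3 - p)))"

end

theory Submission
  imports Defs
begin

text \<open>
  Why the phase jumps.  Since \<open>- p / (j\<^sup>2 - p\<^sup>2)\<close> has simple poles at \<open>p = - j\<close> and \<open>p = j\<close>, and the
  curve \<open>w\<^sub>2 = h\<close> approaches both as \<open>h \<rightarrow> 0\<close>, the factor \<open>h\<close> in the phase integrand is compensated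
  exactly by what happens at the two ends of \<open>[r\<^sub>1, r\<^sub>2]\<close>.  On each of \<open>[r\<^sub>1, 0]\<close> and \<open>[0, r\<^sub>2]\<close> the
  integrand is a continuous weight, depending on \<open>h\<close> only through \<open>r\<^sub>1\<close>, times \<open>h\<close> times an
  elementary singular kernel.  The kernels concentrate at \<open>- j\<close> and at \<open>j\<close> as \<open>h \<rightarrow> 0\<close>, so the
  integral tends to the value of the weight there times the limit mass of the kernel
  (lemma \<open>concentrated_integral_tendsto\<close>).  The masses come from explicit antiderivatives.  Near
  \<open>- j\<close>, a smooth point of the reduced space, a single root \<open>r\<^sub>1\<close> tends to \<open>- j\<close> and an arctangent
  contributes \<open>\<pi> / 2\<close>.  Near the conical point \<open>j\<close> the two roots \<open>r\<^sub>2\<close> and \<open>r\<^sub>3\<close> merge and an arcsine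
  contributes only half as much, with the opposite sign (lemmas \<open>left_part_tendsto\<close> and
  \<open>right_part_tendsto\<close>).  The roots are even in \<open>h\<close> and the integrand is odd in \<open>h\<close>, which gives the
  limits from the left and hence the jump.

  The integral is the phase change because the phase, minus or plus the indefinite integral of the
  integrand evaluated at \<open>\<pi>\<^sub>3\<close>, is constant on each half of a traversal (lemma \<open>phase_change\<close>).  Every
  motion of the drift system along \<open>w\<^sub>2 = h\<close> obeys the phase equation: \<open>dw\<^sub>2/dt = a w\<^sub>1\<close> forces
  \<open>a = 0\<close>, and the continuous angle is differentiable because its sine is (lemma
  \<open>drift_traversal_phase\<close>).  Such motions exist: with \<open>\<pi>\<^sub>3\<close> written as midpoint plus half length
  times a cosine, the reduced equation is solved by separation of variables and then lifted
  (lemmas \<open>lifted_motion\<close> and \<open>drift_traversal_exists\<close>).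
\<close>

section \<open>The cubic and its roots near the homoclinic orbit\<close>

text \<open>
  The bound \<open>4 j\<^sup>3\<close> keeps \<open>y\<close> below the values of \<open>8 (p - j)\<^sup>2 (p + j)\<close> at \<open>- 3 j / 4\<close> and
  at \<open>0\<close>, so the two roots in \<open>(- j, j)\<close> lie on either side of \<open>[- 3 j / 4, 0]\<close>.  The gap
  \<open>r\<^sub>1 < - 3 j / 4\<close> keeps the quadratic \<open>(r\<^sub>2 - p) (r\<^sub>3 - p)\<close>, written in terms of \<open>r\<^sub>1\<close> alone,
  positive on the whole of \<open>[r\<^sub>1, 0]\<close>, uniformly in \<open>h\<close>.
\<close>

lemma cubic_roots:
  fixes j y :: real
  assumes "j > 0" "0 < y" "y < 4 * j ^ 3"
  shows "\<exists>r1 r2 r3. - j < r1 \<and> r1 < - (3 * j / 4) \<and> 0 < r2 \<and> r2 < j \<and> j < r3 \<and>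
    (\<forall>p. 8 * (p - j)\<^sup>2 * (p + j) - y = 8 * (p - r1) * (p - r2) * (p - r3))"
proof -
  define F where "F p = 8 * (p - j)\<^sup>2 * (p + j) - y" for p
  have cont: "continuous_on A F" for A
    unfolding F_def by (intro continuous_intros)
  have Fneg: "F (- j) < 0" "F j < 0"
    using assms by (simp_all add: F_def)
  have j3: "j ^ 3 > 0"
    using assms by simp
  have "F (- (3 * j / 4)) = 49 / 8 * j ^ 3 - y" "F 0 = 8 * j ^ 3 - y"
    by (simp_all add: F_def power2_eq_square power3_eq_cube algebra_simps)
  with assms j3 have Fpos: "F (- (3 * j / 4)) > 0" "F 0 > 0"
    by linarith+
  obtain r1 where r1: "- j \<le> r1" "r1 \<le> - (3 * j / 4)" "F r1 = 0"
    using IVT'[of F "- j" 0 "- (3 * j / 4)"] Fneg Fpos cont assms by auto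
  obtain r2 where r2: "0 \<le> r2" "r2 \<le> j" "F r2 = 0"
    using IVT2'[of F j 0 0] Fneg Fpos cont assms by auto
  have strict: "- j < r1" "r1 < - (3 * j / 4)" "0 < r2" "r2 < j"
    using r1 r2 Fneg Fpos by (force simp: less_le)+
  \<comment> \<open>The coefficient of \<open>p\<^sup>2\<close> in the monic cubic is \<open>- j\<close>, so the roots sum to \<open>j\<close>.\<close>
  define r3 where "r3 = j - r1 - r2"
  have y: "y = 8 * (r1 - j)\<^sup>2 * (r1 + j)"
    using r1 by (simp add: F_def)
  have "F r1 - F r2 = 8 * ((r1 - r2) * (r1\<^sup>2 + r1 * r2 + r2\<^sup>2 - j * (r1 + r2) - j\<^sup>2))"
    unfolding F_def by algebra
  hence "(r1 - r2) * (r1\<^sup>2 + r1 * r2 + r2\<^sup>2 - j * (r1 + r2) - j\<^sup>2) = 0"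
    using r1(3) r2(3) by simp
  moreover have "r1 \<noteq> r2"
    using strict assms by auto
  ultimately have quad: "r1\<^sup>2 + r1 * r2 + r2\<^sup>2 - j * (r1 + r2) - j\<^sup>2 = 0"
    by simp
  have fact: "F p = 8 * (p - r1) * (p - r2) * (p - r3)" for p
    unfolding F_def y r3_def using quad by algebra
  have "8 * (j - r1) * (j - r2) * (r3 - j) = y"
    using fact[of j] by (simp add: F_def algebra_simps)
  with assms(2) have "0 < (8 * (j - r1) * (j - r2)) * (r3 - j)"
    by simp
  moreover have "8 * (j - r1) * (j - r2) > 0"
    using strict assms by simp
  ultimately have "j < r3"
    by (metis diff_gt_0_iff_gt zero_less_mult_pos)
  with strict fact show ?thesis
    unfolding F_def by blast
qed

locale near_homoclinic =
  fixes j h r1 r2 r3 :: real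
  assumes j_pos: "j > 0"
    and r1_gt: "- j < r1" and r1_less: "r1 < - (3 * j / 4)"
    and r2_pos: "0 < r2" and r2_less: "r2 < j" and r3_gt: "j < r3"
    and factorization: "8 * (p - j)\<^sup>2 * (p + j) - h\<^sup>2 = 8 * (p - r1) * (p - r2) * (p - r3)"
begin

lemma order: "r1 < 0" "r1 < r2" "r2 < r3"
  using j_pos r1_gt r1_less r2_pos r2_less r3_gt by linarith+

lemma roots: "{p. 8 * (p - j)\<^sup>2 * (p + j) - h\<^sup>2 = 0} = {r1, r2, r3}"
  unfolding factorization by auto

lemma root_sum: "r1 + r2 + r3 = j"
  using factorization[of 0] factorization[of 1] factorization[of "-1"] by algebra

text \<open>
  The integrand depends on \<open>h\<close> through three roots, but away from a singular factor it can be
  written with \<open>r\<^sub>1\<close> only; that is what makes it a continuous function of two variables on a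
  fixed compact set.
\<close>

lemma root_products:
  "(r2 - p) * (r3 - p) = p\<^sup>2 + p * r1 + r1\<^sup>2 - j * p - j * r1 - j\<^sup>2"
proof -
  have "r1 * r2 + r1 * r3 + r2 * r3 = - (j\<^sup>2)"
    using factorization[of 0] factorization[of 1] factorization[of "-1"] by algebra
  moreover have r3: "r3 = j - r1 - r2"
    using root_sum by simp
  ultimately show ?thesis
    unfolding r3 by algebra
qed

lemma h_sq_left: "h\<^sup>2 = 8 * (j - r1)\<^sup>2 * (j + r1)"
  using factorization[of r1] by (simp add: power2_eq_square algebra_simps)

lemma h_sq_right: "h\<^sup>2 = 8 * (j - r1) * ((j - r2) * (r3 - j))"
  using factorization[of j] by (simp add: algebra_simps)

text \<open>
  Below \<open>p = j < r\<^sub>3\<close> the cubic is nonnegative exactly on \<open>[r\<^sub>1, r\<^sub>2]\<close>; the third root belongs to a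
  branch outside the reduced space.
\<close>

lemma reduced_curve:
  "(w, h, p) \<in> reduced_space j \<longleftrightarrow>
     w\<^sup>2 + h\<^sup>2 = 8 * (p\<^sup>2 - j\<^sup>2) * (p - j) \<and> r1 \<le> p \<and> p \<le> r2"
proof -
  have eq: "8 * (p\<^sup>2 - j\<^sup>2) * (p - j) = 8 * (p - j)\<^sup>2 * (p + j)"
    by (simp add: power2_eq_square algebra_simps)
  have "r1 \<le> p \<and> p \<le> r2"
    if "w\<^sup>2 + h\<^sup>2 = 8 * (p - j)\<^sup>2 * (p + j)" "p \<le> j"
  proof -
    have "w\<^sup>2 = 8 * (p - r1) * (p - r2) * (p - r3)"
      using that factorization[of p] by simp
    hence "((p - r1) * (r2 - p)) * (8 * (r3 - p)) = w\<^sup>2"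
      by algebra
    hence "((p - r1) * (r2 - p)) * (8 * (r3 - p)) \<ge> 0"
      by simp
    moreover have "8 * (r3 - p) > 0"
      using that r3_gt by simp
    ultimately have "(p - r1) * (r2 - p) \<ge> 0"
      by (metis mult.commute zero_le_mult_iff not_less)
    thus ?thesis
      using order unfolding zero_le_mult_iff by linarith
  qed
  moreover have "- j \<le> p \<and> p \<le> j" if "r1 \<le> p \<and> p \<le> r2"
    using that r1_gt r2_less by linarith
  ultimately show ?thesis
    unfolding reduced_space_def eq mem_Collect_eq prod.case by blast
qed

section \<open>The two singular kernels\<close>

text \<open>
  Since \<open>j\<^sup>2 - p\<^sup>2 = (j - p) (j + p)\<close>, the phase integrand concentrates at \<open>p = - j\<close> through the
  factor \<open>1 / ((j + p) \<surd>(p - r\<^sub>1))\<close> and at \<open>p = j\<close> through \<open>1 / ((j - p) \<surd>((r\<^sub>2 - p) (r\<^sub>3 - p)))\<close>.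
  Both are elementary.  Here \<open>p - r\<^sub>1 = (j + r\<^sub>1) tan\<^sup>2 \<psi>\<close> turns the integral into that of a constant.
\<close>

lemma left_kernel_integral:
  assumes "r1 \<le> b"
  shows "((\<lambda>p. 1 / ((j + p) * sqrt (p - r1))) has_integral
     2 / sqrt (j + r1) * arctan (sqrt (b - r1) / sqrt (j + r1))) {r1..b}"
proof -
  define R where "R = sqrt (j + r1)"
  have R: "R > 0" "R\<^sup>2 = j + r1"
    using r1_gt by (simp_all add: R_def)
  let ?K = "\<lambda>p. 2 / R * arctan (sqrt (p - r1) / R)"
  have "((\<lambda>p. 1 / ((j + p) * sqrt (p - r1))) has_integral (?K b - ?K r1)) {r1..b}"
  proof (rule fundamental_theorem_of_calculus_interior)
    show "continuous_on {r1..b} ?K"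
      using R by (intro continuous_intros) auto
    fix p assume p: "p \<in> {r1<..<b}"
    have S: "sqrt (p - r1) > 0" "(sqrt (p - r1))\<^sup>2 = p - r1"
      using p by auto
    have "(?K has_real_derivative
       2 / R * (inverse (1 + (sqrt (p - r1) / R)\<^sup>2) * (inverse (sqrt (p - r1)) / 2 / R))) (at p)"
      using p R(1) by (auto intro!: derivative_eq_intros simp: mult.commute)
    moreover have "1 + (sqrt (p - r1) / R)\<^sup>2 = (j + p) / R\<^sup>2"
    proof -
      have "1 + (sqrt (p - r1) / R)\<^sup>2 = (R\<^sup>2 + (p - r1)) / R\<^sup>2"
        using R(1) by (simp only: power_divide S add_divide_distrib) simp
      thus ?thesis
        by (simp add: R(2))
    qed
    moreover have "2 / R * (inverse ((j + p) / R\<^sup>2) * (inverse (sqrt (p - r1)) / 2 / R)) =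
        1 / ((j + p) * sqrt (p - r1))"
      using R(1) by (simp add: divide_simps power2_eq_square)
    ultimately show "(?K has_vector_derivative 1 / ((j + p) * sqrt (p - r1))) (at p)"
      by (simp add: has_real_derivative_iff_has_vector_derivative)
  qed (use assms in auto)
  thus ?thesis
    by (simp add: R_def)
qed

text \<open>
  An integrable majorant for the kernel times the distance to its point of concentration; after
  multiplication by \<open>h\<close> its integral vanishes in the limit.  The analogous lemma at the other end
  serves the same purpose.
\<close>

lemma left_moment_integral:
  assumes "r1 \<le> b"
  shows "((\<lambda>p. 1 / sqrt (p - r1)) has_integral 2 * sqrt (b - r1)) {r1..b}"
proof -
  have "((\<lambda>p. 1 / sqrt (p - r1)) has_integral (2 * sqrt (b - r1) - 2 * sqrt (r1 - r1))) {r1..b}"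
  proof (rule fundamental_theorem_of_calculus_interior)
    fix p assume p: "p \<in> {r1<..<b}"
    have "((\<lambda>p. 2 * sqrt (p - r1)) has_real_derivative 1 / sqrt (p - r1)) (at p)"
      using p by (auto intro!: derivative_eq_intros simp: field_simps)
    thus "((\<lambda>p. 2 * sqrt (p - r1)) has_vector_derivative 1 / sqrt (p - r1)) (at p)"
      by (simp add: has_real_derivative_iff_has_vector_derivative)
  qed (use assms in \<open>auto intro!: continuous_intros\<close>)
  thus ?thesis
    by simp
qed

text \<open>
  Substituting \<open>1 / (j - p)\<close> makes the radicand a quadratic with negative leading coefficient,
  whence the arcsine; \<open>E\<close> is the affine function of \<open>1 / (j - p)\<close> that takes the value \<open>1\<close> at
  \<open>p = r\<^sub>2\<close> and \<open>- 1\<close> at \<open>p = r\<^sub>3\<close>.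
\<close>

lemma right_kernel_integral:
  assumes "a \<le> r2"
  defines "E \<equiv> \<lambda>p. (2 * ((j - r2) * (r3 - j)) / (j - p) + (j + r1)) / (r3 - r2)"
  shows "((\<lambda>p. 1 / ((j - p) * sqrt ((r2 - p) * (r3 - p)))) has_integral
     (pi / 2 - arcsin (E a)) / sqrt ((j - r2) * (r3 - j))) {a..r2}"
proof -
  define D where "D = sqrt ((j - r2) * (r3 - j))"
  have D: "D > 0" "(j - r2) * (r3 - j) = D\<^sup>2"
    using r2_less r3_gt by (simp_all add: D_def)
  have s: "r3 - r2 > 0"
    using order by simp
  have j_r1: "j + r1 = (j - r2) - (r3 - j)"
    using root_sum by simp
  have E2: "1 - (E p)\<^sup>2 = (2 * D * sqrt ((r2 - p) * (r3 - p)) / ((j - p) * (r3 - r2)))\<^sup>2"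
    if "p \<le> r2" for p
  proof -
    have v: "j - p \<noteq> 0"
      using that r2_less by simp
    have nn: "(r2 - p) * (r3 - p) \<ge> 0"
      using that order by simp
    have "E p = (2 * D\<^sup>2 + (2 * j - r2 - r3) * (j - p)) / ((j - p) * (r3 - r2))"
      unfolding E_def j_r1 D(2) using v s by (simp add: field_simps)
    hence "1 - (E p)\<^sup>2 = (((j - p) * (r3 - r2))\<^sup>2 -
        (2 * D\<^sup>2 + (2 * j - r2 - r3) * (j - p))\<^sup>2) / ((j - p) * (r3 - r2))\<^sup>2"
      using v s by (simp add: power_divide diff_divide_eq_iff)
    also have "((j - p) * (r3 - r2))\<^sup>2 - (2 * D\<^sup>2 + (2 * j - r2 - r3) * (j - p))\<^sup>2 =
        4 * D\<^sup>2 * ((r2 - p) * (r3 - p))"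
      unfolding D(2)[symmetric] by algebra
    also have "\<dots> = (2 * D * sqrt ((r2 - p) * (r3 - p)))\<^sup>2"
      using nn by (simp add: power_mult_distrib)
    finally show ?thesis
      by (simp add: power_divide)
  qed
  have pos: "2 * D * sqrt ((r2 - p) * (r3 - p)) / ((j - p) * (r3 - r2)) > 0" if "p < r2" for p
    using that D s r2_less order by simp
  have lt1: "(E p)\<^sup>2 < 1" if "p < r2" for p
  proof -
    have "1 - (E p)\<^sup>2 > 0"
      unfolding E2[OF less_imp_le[OF that]] by (rule zero_less_power[OF pos[OF that]])
    thus ?thesis
      by simp
  qed
  have E_r2: "E r2 = 1"
  proof -
    have "2 * ((j - r2) * (r3 - j)) / (j - r2) + (j + r1) = r3 - r2"
      unfolding j_r1 using r2_less by simp
    thus ?thesis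
      unfolding E_def using s by simp
  qed
  let ?K = "\<lambda>p. arcsin (E p) / D"
  have "((\<lambda>p. 1 / ((j - p) * sqrt ((r2 - p) * (r3 - p)))) has_integral (?K r2 - ?K a)) {a..r2}"
  proof (rule fundamental_theorem_of_calculus_interior)
    have "(E p)\<^sup>2 \<le> 1" if "p \<le> r2" for p
      using lt1[of p] E_r2 that by (cases "p = r2") auto
    hence "\<forall>p\<in>{a..r2}. - 1 \<le> E p \<and> E p \<le> 1"
      by (auto simp: abs_le_square_iff[of _ 1, simplified, symmetric] abs_le_iff)
    moreover have "continuous_on {a..r2} E"
      unfolding E_def using r2_less s by (auto intro!: continuous_intros)
    ultimately show "continuous_on {a..r2} ?K"
      using D by (auto intro!: continuous_intros)
    fix p assume "p \<in> {a<..<r2}"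
    hence p: "p < r2"
      by simp
    have v: "j - p > 0"
      using p r2_less by simp
    have "((\<lambda>p. 2 * D\<^sup>2 / (j - p) + (j + r1)) has_real_derivative 2 * D\<^sup>2 / (j - p)\<^sup>2) (at p)"
      using v by (auto intro!: derivative_eq_intros simp: power2_eq_square)
    hence "(E has_real_derivative 2 * D\<^sup>2 / ((j - p)\<^sup>2 * (r3 - r2))) (at p)"
      unfolding E_def D(2) using DERIV_cdivide by fastforce
    moreover have "- 1 < E p" "E p < 1"
      using lt1[OF p] unfolding abs_square_less_1 by linarith+
    ultimately have "(?K has_real_derivative
        2 * D\<^sup>2 / ((j - p)\<^sup>2 * (r3 - r2)) * inverse (sqrt (1 - (E p)\<^sup>2)) / D) (at p)"
      using D(1) by (auto intro!: derivative_eq_intros simp: ac_simps)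
    moreover have "sqrt (1 - (E p)\<^sup>2) =
        2 * D * sqrt ((r2 - p) * (r3 - p)) / ((j - p) * (r3 - r2))"
      unfolding E2[OF less_imp_le[OF p]]
      by (rule real_sqrt_unique[OF refl less_imp_le[OF pos[OF p]]])
    moreover have "2 * D\<^sup>2 / ((j - p)\<^sup>2 * (r3 - r2)) *
        inverse (2 * D * sqrt ((r2 - p) * (r3 - p)) / ((j - p) * (r3 - r2))) / D =
        1 / ((j - p) * sqrt ((r2 - p) * (r3 - p)))"
      using v D s by (simp add: divide_simps power2_eq_square)
    ultimately show "(?K has_vector_derivative
        1 / ((j - p) * sqrt ((r2 - p) * (r3 - p)))) (at p)"
      by (simp add: has_real_derivative_iff_has_vector_derivative)
  qed (use assms in auto)
  thus "((\<lambda>p. 1 / ((j - p) * sqrt ((r2 - p) * (r3 - p)))) has_integral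
     (pi / 2 - arcsin (E a)) / sqrt ((j - r2) * (r3 - j))) {a..r2}"
    unfolding E_r2 D_def by (simp add: diff_divide_distrib)
qed

lemma right_moment_integral:
  assumes "a \<le> r2"
  shows "((\<lambda>p. 1 / sqrt (r2 - p)) has_integral 2 * sqrt (r2 - a)) {a..r2}"
proof -
  have "((\<lambda>p. 1 / sqrt (r2 - p)) has_integral
      (- 2 * sqrt (r2 - r2) - (- 2 * sqrt (r2 - a)))) {a..r2}"
  proof (rule fundamental_theorem_of_calculus_interior)
    fix p assume p: "p \<in> {a<..<r2}"
    have "((\<lambda>p. - 2 * sqrt (r2 - p)) has_real_derivative 1 / sqrt (r2 - p)) (at p)"
      using p by (auto intro!: derivative_eq_intros simp: field_simps)
    thus "((\<lambda>p. - 2 * sqrt (r2 - p)) has_vector_derivative 1 / sqrt (r2 - p)) (at p)"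
      by (simp add: has_real_derivative_iff_has_vector_derivative)
  qed (use assms in \<open>auto intro!: continuous_intros\<close>)
  thus ?thesis
    by simp
qed

end

section \<open>Limits of concentrating integrals\<close>

text \<open>
  Close to \<open>z\<^sub>0\<close> the error is at most \<open>e\<close> by continuity; further away boundedness gives a
  multiple of the distance.  This is a substitute for a Lipschitz estimate.
\<close>

lemma compact_affine_modulus:
  fixes f :: "'a::metric_space \<Rightarrow> real"
  assumes "compact K" "continuous_on K f" "z0 \<in> K" "e > 0"
  shows "\<exists>C\<ge>0. \<forall>z\<in>K. \<bar>f z - f z0\<bar> \<le> e + C * dist z z0"
proof -
  obtain d where d: "d > 0" "\<And>z. z \<in> K \<Longrightarrow> dist z z0 < d \<Longrightarrow> dist (f z) (f z0) < e"
    using assms unfolding continuous_on_iff by metis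
  have "bounded (f ` K)"
    using assms by (intro compact_imp_bounded compact_continuous_image)
  then obtain B where B: "\<And>z. z \<in> K \<Longrightarrow> \<bar>f z\<bar> \<le> B"
    unfolding bounded_iff by auto
  have B0: "B \<ge> 0"
    using B[OF assms(3)] by linarith
  have "\<bar>f z - f z0\<bar> \<le> e + 2 * B / d * dist z z0" if z: "z \<in> K" for z
  proof (cases "dist z z0 < d")
    case True
    have "2 * B / d * dist z z0 \<ge> 0"
      using B0 d by simp
    with d(2)[OF z True] show ?thesis
      unfolding dist_real_def by linarith
  next
    case False
    have "2 * B = 2 * B / d * d"
      using d by simp
    also have "\<dots> \<le> 2 * B / d * dist z z0"
      using False B0 d by (intro mult_left_mono) auto
    finally show ?thesis
      using B[OF z] B[OF assms(3)] assms(4) by linarith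
  qed
  moreover have "2 * B / d \<ge> 0"
    using B0 d by simp
  ultimately show ?thesis
    by blast
qed

text \<open>
  If the mass of the kernels \<open>k h\<close> accumulates at \<open>p\<^sub>0\<close>, in the sense that their mass converges and
  their first absolute moment about \<open>p\<^sub>0\<close> vanishes, then integrating a continuous weight against
  them evaluates the weight at \<open>p\<^sub>0\<close>.  The affine bound on \<open>f - f (r\<^sub>0, p\<^sub>0)\<close> reduces the error to
  mass and moment.
\<close>

lemma concentrated_integral_tendsto:
  fixes f :: "real \<times> real \<Rightarrow> real" and k M :: "'i \<Rightarrow> real \<Rightarrow> real"
    and r c \<mu> :: "'i \<Rightarrow> real" and S :: "'i \<Rightarrow> real set"
  assumes K: "compact K" "continuous_on K f" "(r0, p0) \<in> K"
    and dom: "\<forall>\<^sub>F h in F. \<forall>p\<in>S h. (r h, p) \<in> K"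
    and kernel: "\<forall>\<^sub>F h in F. \<forall>p\<in>S h. 0 \<le> k h p \<and> \<bar>p - p0\<bar> * k h p \<le> M h p"
    and mass: "\<forall>\<^sub>F h in F. (k h has_integral c h) (S h)" "(c \<longlongrightarrow> c0) F"
    and moment: "\<forall>\<^sub>F h in F. (M h has_integral \<mu> h) (S h)" "(\<mu> \<longlongrightarrow> 0) F"
    and r: "(r \<longlongrightarrow> r0) F"
    and int: "\<forall>\<^sub>F h in F. (\<lambda>p. f (r h, p) * k h p) integrable_on S h"
  shows "((\<lambda>h. integral (S h) (\<lambda>p. f (r h, p) * k h p)) \<longlongrightarrow> f (r0, p0) * c0) F"
proof -
  let ?I = "\<lambda>h. integral (S h) (\<lambda>p. f (r h, p) * k h p)"
  have "((\<lambda>h. ?I h - f (r0, p0) * c h) \<longlongrightarrow> 0) F"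
  proof (rule tendstoI)
    fix \<epsilon> :: real
    assume \<epsilon>: "\<epsilon> > 0"
    define e where "e = \<epsilon> / (2 * (\<bar>c0\<bar> + 1))"
    have e: "e > 0"
      using \<epsilon> by (simp add: e_def)
    have "e * c0 \<le> e * (\<bar>c0\<bar> + 1)"
      using e by (intro mult_left_mono) auto
    also have "e * (\<bar>c0\<bar> + 1) = \<epsilon> / 2"
      by (simp add: e_def field_simps)
    also have "\<dots> < \<epsilon>"
      using \<epsilon> by simp
    finally have ec0: "e * c0 < \<epsilon>" .
    obtain C where C: "C \<ge> 0"
      "\<And>z. z \<in> K \<Longrightarrow> \<bar>f z - f (r0, p0)\<bar> \<le> e + C * dist z (r0, p0)"
      using compact_affine_modulus[OF K e] by blast
    let ?b = "\<lambda>h. (e + C * \<bar>r h - r0\<bar>) * c h + C * \<mu> h"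
    have "(?b \<longlongrightarrow> (e + C * \<bar>r0 - r0\<bar>) * c0 + C * 0) F"
      by (intro tendsto_intros mass moment r)
    hence "\<forall>\<^sub>F h in F. ?b h < \<epsilon>"
      using ec0 by (intro order_tendstoD) auto
    thus "\<forall>\<^sub>F h in F. dist (?I h - f (r0, p0) * c h) 0 < \<epsilon>"
      using dom kernel mass(1) moment(1) int
    proof eventually_elim
      case (elim h)
      have ki: "k h integrable_on S h" "integral (S h) (k h) = c h"
        using elim by (auto intro: integral_unique)
      have Mi: "M h integrable_on S h" "integral (S h) (M h) = \<mu> h"
        using elim by (auto intro: integral_unique)
      let ?g = "\<lambda>p. (e + C * \<bar>r h - r0\<bar>) * k h p + C * M h p"
      have "(?g has_integral ?b h) (S h)"
        by (intro has_integral_add has_integral_mult_right elim)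
      hence g: "?g integrable_on S h" "integral (S h) ?g = ?b h"
        by (auto intro: integral_unique)
      have fk0: "(\<lambda>p. f (r0, p0) * k h p) integrable_on S h"
        using integrable_cmul[OF ki(1), of "f (r0, p0)"] by simp
      have "?I h - f (r0, p0) * c h =
          integral (S h) (\<lambda>p. f (r h, p) * k h p - f (r0, p0) * k h p)"
        using elim fk0 ki by (subst integral_diff) auto
      also have "norm \<dots> \<le> integral (S h) ?g"
      proof (rule integral_norm_bound_integral)
        show "(\<lambda>p. f (r h, p) * k h p - f (r0, p0) * k h p) integrable_on S h"
          using elim fk0 by (intro integrable_diff) auto
        fix p assume p: "p \<in> S h"
        have k0: "k h p \<ge> 0" and kM: "\<bar>p - p0\<bar> * k h p \<le> M h p"
          using elim p by auto
        have "dist (r h, p) (r0, p0) \<le> \<bar>r h - r0\<bar> + \<bar>p - p0\<bar>"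
          by (simp add: dist_Pair_Pair dist_real_def sqrt_sum_squares_le_sum_abs)
        hence "C * dist (r h, p) (r0, p0) \<le> C * (\<bar>r h - r0\<bar> + \<bar>p - p0\<bar>)"
          using C(1) by (intro mult_left_mono)
        moreover have "\<bar>f (r h, p) - f (r0, p0)\<bar> \<le> e + C * dist (r h, p) (r0, p0)"
          using elim p by (intro C(2)) auto
        ultimately have "\<bar>f (r h, p) - f (r0, p0)\<bar> \<le> e + C * (\<bar>r h - r0\<bar> + \<bar>p - p0\<bar>)"
          by linarith
        hence "\<bar>f (r h, p) - f (r0, p0)\<bar> * k h p \<le> (e + C * (\<bar>r h - r0\<bar> + \<bar>p - p0\<bar>)) * k h p"
          using k0 by (intro mult_right_mono)
        also have "\<dots> = (e + C * \<bar>r h - r0\<bar>) * k h p + C * (\<bar>p - p0\<bar> * k h p)"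
          by (simp add: algebra_simps)
        also have "\<dots> \<le> ?g p"
          using kM C(1) by (intro add_left_mono mult_left_mono)
        finally show "norm (f (r h, p) * k h p - f (r0, p0) * k h p) \<le> ?g p"
          using k0 by (simp add: left_diff_distrib[symmetric] abs_mult)
      qed (rule g)
      finally show ?case
        using elim by (simp add: g(2))
    qed
  qed
  moreover have "((\<lambda>h. f (r0, p0) * c h) \<longlongrightarrow> f (r0, p0) * c0) F"
    by (intro tendsto_intros mass)
  ultimately have "((\<lambda>h. (?I h - f (r0, p0) * c h) + f (r0, p0) * c h) \<longlongrightarrow> 0 + f (r0, p0) * c0) F"
    by (rule tendsto_add)
  thus ?thesis
    by simp
qed

section \<open>The phase integrand as weight times kernel\<close>

text \<open>
  The factor of the phase integrand that stays continuous at \<open>p = - j\<close> (left) or at \<open>p = j\<close>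
  (right), as a function of the smallest root and \<open>p\<close>.
\<close>

definition left_weight :: "real \<Rightarrow> real \<times> real \<Rightarrow> real" where
  "left_weight j = (\<lambda>(r, p).
     - p / ((j - p) * sqrt (8 * (p\<^sup>2 + p * r + r\<^sup>2 - j * p - j * r - j\<^sup>2))))"

definition right_weight :: "real \<Rightarrow> real \<times> real \<Rightarrow> real" where
  "right_weight j = (\<lambda>(r, p). - p / ((j + p) * sqrt (8 * (p - r))))"

definition left_domain :: "real \<Rightarrow> (real \<times> real) set" where
  "left_domain j = {- j..- (3 * j / 4)} \<times> {- j..0}"

definition right_domain :: "real \<Rightarrow> (real \<times> real) set" where
  "right_domain j = {- j..- (3 * j / 4)} \<times> {0..j}"

lemma compact_domains: "compact (left_domain j)" "compact (right_domain j)"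
  by (simp_all add: left_domain_def right_domain_def compact_Times)

lemma continuous_left_weight:
  assumes "j > 0"
  shows "continuous_on (left_domain j) (left_weight j)"
proof -
  have "p\<^sup>2 + p * r + r\<^sup>2 - j * p - j * r - j\<^sup>2 > 0"
    if "(r, p) \<in> left_domain j" for r p
  proof -
    have rp: "r \<le> - (3 * j / 4)" "p \<le> 0" "r \<le> 0"
      using that assms by (auto simp: left_domain_def)
    have "p * r \<ge> 0" "j * p \<le> 0"
      using rp assms by (simp_all add: mult_nonpos_nonpos mult_nonneg_nonpos)
    moreover have "(3 * j / 4)\<^sup>2 \<le> (- r)\<^sup>2"
      using rp assms by (intro power_mono) auto
    moreover have "j * (3 * j / 4) \<le> j * (- r)"
      using rp assms by (intro mult_left_mono) auto
    moreover have "j\<^sup>2 > 0"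
      using assms by simp
    ultimately show ?thesis
      using zero_le_square[of p] unfolding power2_eq_square by linarith
  qed
  moreover have "j - p > 0" if "(r, p) \<in> left_domain j" for r p
    using that assms by (auto simp: left_domain_def)
  ultimately show ?thesis
    unfolding left_weight_def case_prod_unfold
    by (intro continuous_intros) (fastforce simp: less_le)
qed

lemma continuous_right_weight:
  assumes "j > 0"
  shows "continuous_on (right_domain j) (right_weight j)"
proof -
  have "p - r > 0" "j + p > 0" if "(r, p) \<in> right_domain j" for r p
    using that assms by (auto simp: right_domain_def)
  thus ?thesis
    unfolding right_weight_def case_prod_unfold
    by (intro continuous_intros) (fastforce simp: less_le)
qed

text \<open>
  The integrand is unbounded at the turning points; it is absolutely integrable because the
  kernel is and the weight is bounded.
\<close>

lemma continuous_slice_absolutely_integrable: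
  fixes f :: "'a::metric_space \<times> real \<Rightarrow> real"
  assumes "continuous_on K f" "\<And>p. p \<in> {a..b} \<Longrightarrow> (r, p) \<in> K" "g absolutely_integrable_on {a..b}"
  shows "(\<lambda>p. f (r, p) * g p) absolutely_integrable_on {a..b}"
proof (rule absolutely_integrable_bounded_measurable_product_real)
  have cont: "continuous_on {a..b} (\<lambda>p. f (r, p))"
    using assms by (intro continuous_on_compose2[OF assms(1)]) (auto intro!: continuous_intros)
  thus "(\<lambda>p. f (r, p)) \<in> borel_measurable (lebesgue_on {a..b})"
    by (intro continuous_imp_measurable_on_sets_lebesgue) auto
  show "bounded ((\<lambda>p. f (r, p)) ` {a..b})"
    using cont by (intro compact_imp_bounded compact_continuous_image) auto
qed (use assms in auto)

context near_homoclinic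
begin

abbreviation integrand :: "real \<Rightarrow> real" where
  "integrand \<equiv> phase_integrand j h r1 r2 r3"

abbreviation left_kernel :: "real \<Rightarrow> real" where
  "left_kernel \<equiv> \<lambda>p. h * (1 / ((j + p) * sqrt (p - r1)))"

abbreviation right_kernel :: "real \<Rightarrow> real" where
  "right_kernel \<equiv> \<lambda>p. h * (1 / ((j - p) * sqrt ((r2 - p) * (r3 - p))))"

lemma integrand_left: "integrand p = left_weight j (r1, p) * left_kernel p"
proof -
  have factors: "8 * (p - r1) * (r2 - p) * (r3 - p) = (p - r1) * (8 * ((r2 - p) * (r3 - p)))"
    "j\<^sup>2 - p\<^sup>2 = (j - p) * (j + p)"
    by algebra+
  show ?thesis
    unfolding phase_integrand_def left_weight_def prod.case root_products[symmetric] factors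
    unfolding real_sqrt_mult by (simp add: ac_simps)
qed

lemma integrand_right: "integrand p = right_weight j (r1, p) * right_kernel p"
proof -
  have factors: "8 * (p - r1) * (r2 - p) * (r3 - p) = (8 * (p - r1)) * ((r2 - p) * (r3 - p))"
    "j\<^sup>2 - p\<^sup>2 = (j - p) * (j + p)"
    by algebra+
  show ?thesis
    unfolding phase_integrand_def right_weight_def prod.case factors
    unfolding real_sqrt_mult by (simp add: ac_simps)
qed

lemma in_domains:
  "p \<in> {r1..0} \<Longrightarrow> (r1, p) \<in> left_domain j"
  "p \<in> {0..r2} \<Longrightarrow> (r1, p) \<in> right_domain j"
  using j_pos r1_gt r1_less r2_less by (auto simp: left_domain_def right_domain_def)

lemma integrand_absolutely_integrable:
  shows "integrand absolutely_integrable_on {r1..0}"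
    and "integrand absolutely_integrable_on {0..r2}"
    and "integrand absolutely_integrable_on {r1..r2}"
proof -
  have "(\<lambda>p. 1 / ((j + p) * sqrt (p - r1))) absolutely_integrable_on {r1..0}"
    using left_kernel_integral[of 0] order r1_gt
    by (intro nonnegative_absolutely_integrable_1) (auto intro!: divide_nonneg_nonneg mult_nonneg_nonneg)
  note kernel = set_integrable_mult_right[where a = h, OF this]
  show 1: "integrand absolutely_integrable_on {r1..0}"
    unfolding integrand_left[abs_def]
    by (rule continuous_slice_absolutely_integrable[OF continuous_left_weight[OF j_pos] in_domains(1) kernel])
  have "(\<lambda>p. 1 / ((j - p) * sqrt ((r2 - p) * (r3 - p)))) absolutely_integrable_on {0..r2}"
    using right_kernel_integral[of 0] order r2_pos r2_less
    by (intro nonnegative_absolutely_integrable_1) (auto intro!: divide_nonneg_nonneg mult_nonneg_nonneg)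
  note kernel = set_integrable_mult_right[where a = h, OF this]
  show 2: "integrand absolutely_integrable_on {0..r2}"
    unfolding integrand_right[abs_def]
    by (rule continuous_slice_absolutely_integrable[OF continuous_right_weight[OF j_pos] in_domains(2) kernel])
  show "integrand absolutely_integrable_on {r1..r2}"
    by (rule absolutely_integrable_on_combine[OF 1 2]) (use order r2_pos in auto)
qed

lemma integrand_integrable: "integrand integrable_on {r1..r2}"
  using integrand_absolutely_integrable(3) by (rule set_lebesgue_integral_eq_integral)

lemma integral_split:
  "integral {r1..r2} integrand = integral {r1..0} integrand + integral {0..r2} integrand"
  by (rule Henstock_Kurzweil_Integration.integral_combine[OF _ _ integrand_integrable, symmetric])
     (use order r2_pos in auto)

end

section \<open>The two partial limits\<close>

context near_homoclinic
begin

text \<open>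
  Evaluating the factorized cubic at \<open>r\<^sub>1\<close> and at \<open>j\<close> expresses \<open>h\<close> by the distances of the roots
  from \<open>- j\<close> and \<open>j\<close>; these identities make the limit masses of the kernels finite and nonzero.
\<close>

lemma h_left: "h > 0 \<Longrightarrow> h = sqrt 8 * (j - r1) * sqrt (j + r1)"
  using h_sq_left r1_gt order j_pos
  by (intro power2_eq_imp_eq[of h]) (auto simp: power_mult_distrib)

lemma h_right: "h > 0 \<Longrightarrow> h = sqrt (8 * (j - r1)) * sqrt ((j - r2) * (r3 - j))"
  using h_sq_right r1_gt order j_pos r2_less r3_gt
  by (intro power2_eq_imp_eq[of h]) (auto simp: power_mult_distrib)

lemma r1_le: "r1 \<le> - j + h\<^sup>2 / (8 * j\<^sup>2)"
proof -
  have "8 * j\<^sup>2 * (j + r1) \<le> 8 * (j - r1)\<^sup>2 * (j + r1)"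
    using r1_gt order j_pos by (intro mult_right_mono mult_left_mono power_mono) auto
  hence "8 * j\<^sup>2 * (j + r1) \<le> h\<^sup>2"
    by (simp add: h_sq_left)
  hence "j + r1 \<le> h\<^sup>2 / (8 * j\<^sup>2)"
    using j_pos by (simp add: field_simps)
  thus ?thesis
    by simp
qed

text \<open>
  At the singular point the distance \<open>r\<^sub>3 - r\<^sub>2\<close> of the merging roots is only of order \<open>h\<close>, while
  \<open>j + r\<^sub>1\<close> is of order \<open>h\<^sup>2\<close>.  The first bound makes the moment of the right kernel vanish (like
  \<open>\<surd>h\<close>), and both together make the argument of the arcsine at
  \<open>p = 0\<close> vanish in the limit.
\<close>

lemma gap_ge:
  assumes "h > 0"
  shows "r3 - r2 \<ge> h / (2 * sqrt j)"
    and "r3 - r2 \<ge> 2 * sqrt ((j - r2) * (r3 - j))"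
proof -
  show gap: "r3 - r2 \<ge> 2 * sqrt ((j - r2) * (r3 - j))"
    using arith_geo_mean_sqrt[of "j - r2" "r3 - j"] r2_less r3_gt by simp
  have "sqrt (8 * (j - r1)) \<le> sqrt (16 * j)"
    using r1_gt by simp
  hence "h \<le> 4 * sqrt j * sqrt ((j - r2) * (r3 - j))"
    using h_right[OF assms] mult_right_mono[of "sqrt (8 * (j - r1))" "sqrt (16 * j)" "sqrt ((j - r2) * (r3 - j))"]
      r2_less r3_gt by (simp add: real_sqrt_mult)
  also have "\<dots> \<le> 4 * sqrt j * ((r3 - r2) / 2)"
    using gap j_pos by (intro mult_left_mono) auto
  finally show "r3 - r2 \<ge> h / (2 * sqrt j)"
    using j_pos by (simp add: field_simps)
qed

text \<open>
  At \<open>p = 0\<close> the argument of the arcsine tends to \<open>0\<close>, the middle of its range \<open>[- 1, 1]\<close>: the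
  kernel sees only a quarter turn \<open>\<pi> / 2\<close> of arcsine, half as much as the limit \<open>\<pi>\<close> of
  \<open>2 arctan\<close> on the left.  This is the source of the limit \<open>\<pi> / 4\<close> instead of \<open>\<pi> / 2\<close>.
\<close>

lemma right_kernel_endpoint:
  assumes "h > 0"
  defines "E \<equiv> (2 * ((j - r2) * (r3 - j)) / j + (j + r1)) / (r3 - r2)"
  shows "0 \<le> E" and "E \<le> h * (1 / (j * sqrt (8 * j)) + sqrt j / (4 * j\<^sup>2))"
proof -
  define D where "D = sqrt ((j - r2) * (r3 - j))"
  have D: "D > 0" "(j - r2) * (r3 - j) = D\<^sup>2"
    using r2_less r3_gt by (simp_all add: D_def)
  have gap: "r3 - r2 \<ge> 2 * D" "r3 - r2 \<ge> h / (2 * sqrt j)"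
    using gap_ge[OF assms(1)] by (simp_all add: D_def)
  show "0 \<le> E"
    unfolding E_def D(2) using j_pos D r1_gt order by simp
  have "sqrt (8 * j) * D \<le> h"
    unfolding h_right[OF assms(1), folded D_def] using order D by (intro mult_right_mono) auto
  hence D_le: "D \<le> h / sqrt (8 * j)"
    using j_pos by (simp add: field_simps)
  have "2 * D\<^sup>2 / j / (r3 - r2) \<le> 2 * D\<^sup>2 / j / (2 * D)"
    using gap D j_pos by (intro divide_left_mono) auto
  also have "\<dots> = D / j"
    using D by (simp add: power2_eq_square)
  also have "\<dots> \<le> h / sqrt (8 * j) / j"
    using D_le j_pos by (intro divide_right_mono) auto
  finally have A: "2 * D\<^sup>2 / j / (r3 - r2) \<le> h * (1 / (j * sqrt (8 * j)))"
    by (simp add: mult.commute)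
  have "(j + r1) / (r3 - r2) \<le> (h\<^sup>2 / (8 * j\<^sup>2)) / (h / (2 * sqrt j))"
    using gap r1_le r1_gt assms j_pos by (intro frac_le) auto
  also have "\<dots> = h * (sqrt j / (4 * j\<^sup>2))"
    using assms j_pos by (simp add: field_simps power2_eq_square)
  finally show "E \<le> h * (1 / (j * sqrt (8 * j)) + sqrt j / (4 * j\<^sup>2))"
    unfolding E_def D(2) add_divide_distrib distrib_left using A by linarith
qed

end

lemma r1_tendsto:
  assumes "\<forall>\<^sub>F h in at_right 0. near_homoclinic j h (r1 h) (r2 h) (r3 h)"
  shows "(r1 \<longlongrightarrow> - j) (at_right 0)"
proof (rule tendsto_sandwich)
  show "\<forall>\<^sub>F h in at_right 0. - j \<le> r1 h"
    using assms by eventually_elim (auto dest: near_homoclinic.r1_gt)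
  show "\<forall>\<^sub>F h in at_right 0. r1 h \<le> - j + h\<^sup>2 / (8 * j\<^sup>2)"
    using assms by eventually_elim (rule near_homoclinic.r1_le)
  have "((\<lambda>h. - j + h\<^sup>2 / (8 * j\<^sup>2)) \<longlongrightarrow> - j + 0\<^sup>2 / (8 * j\<^sup>2)) (at_right 0)"
    by (cases "j = 0") (auto intro!: tendsto_eq_intros)
  thus "((\<lambda>h. - j + h\<^sup>2 / (8 * j\<^sup>2)) \<longlongrightarrow> - j) (at_right 0)"
    by simp
qed simp

text \<open>
  The kernel times \<open>h\<close> has mass \<open>2 \<surd>8 (j - r\<^sub>1) arctan (\<dots>)\<close>, with an argument growing like
  \<open>1 / h\<close>; the limit of the mass is \<open>2 \<surd>8 j \<pi>\<close>, and the weight at \<open>(- j, - j)\<close> is \<open>1 / (4 \<surd>8 j)\<close>.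
\<close>

lemma left_part_tendsto:
  assumes "j > 0" and near: "\<forall>\<^sub>F h in at_right 0. near_homoclinic j h (r1 h) (r2 h) (r3 h)"
  shows "((\<lambda>h. integral {r1 h..0} (phase_integrand j h (r1 h) (r2 h) (r3 h))) \<longlongrightarrow> pi / 2) (at_right 0)"
proof -
  note r1 = r1_tendsto[OF near]
  have h_pos: "\<forall>\<^sub>F h in at_right 0. h > (0::real)"
    by (simp add: eventually_at_right_less)
  let ?k = "\<lambda>h p. h * (1 / ((j + p) * sqrt (p - r1 h)))"
  let ?c = "\<lambda>h. h * (2 / sqrt (j + r1 h) * arctan (sqrt (0 - r1 h) / sqrt (j + r1 h)))"
  have lim: "((\<lambda>h. integral {r1 h..0} (\<lambda>p. left_weight j (r1 h, p) * ?k h p)) \<longlongrightarrow>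
      left_weight j (- j, - j) * (2 * sqrt 8 * (j - (- j)) * (pi / 2))) (at_right 0)"
  proof (rule concentrated_integral_tendsto)
    show "compact (left_domain j)"
      by (rule compact_domains)
    show "continuous_on (left_domain j) (left_weight j)"
      using assms by (intro continuous_left_weight)
    show "(- j, - j) \<in> left_domain j"
      using assms by (simp add: left_domain_def)
    show "\<forall>\<^sub>F h in at_right 0. \<forall>p\<in>{r1 h..0}. (r1 h, p) \<in> left_domain j"
      using near by eventually_elim (auto intro: near_homoclinic.in_domains)
    show "\<forall>\<^sub>F h in at_right 0. \<forall>p\<in>{r1 h..0}.
        0 \<le> ?k h p \<and> \<bar>p - - j\<bar> * ?k h p \<le> h * (1 / sqrt (p - r1 h))"
      using near h_pos
    proof eventually_elim
      case (elim h)
      have "- j < r1 h"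
        using elim by (auto dest: near_homoclinic.r1_gt)
      hence "\<bar>p - - j\<bar> = j + p" "j + p > 0" if "p \<in> {r1 h..0}" for p
        using that by auto
      thus ?case
        using elim by (auto intro!: divide_nonneg_nonneg mult_nonneg_nonneg
            simp: less_imp_neq[symmetric] less_imp_le)
    qed
    show "\<forall>\<^sub>F h in at_right 0. (?k h has_integral ?c h) {r1 h..0}"
      using near
    proof eventually_elim
      case (elim h)
      show ?case
        using near_homoclinic.left_kernel_integral[OF elim, of 0] near_homoclinic.order(1)[OF elim]
        by (intro has_integral_mult_right) auto
    qed
    show "(?c \<longlongrightarrow> 2 * sqrt 8 * (j - (- j)) * (pi / 2)) (at_right 0)"
    proof (rule Lim_transform_eventually)
      have jr1: "\<forall>\<^sub>F h in at_right 0. 0 < sqrt (j + r1 h)"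
        using near by eventually_elim (auto dest: near_homoclinic.r1_gt)
      have "((\<lambda>h. sqrt (j + r1 h)) \<longlongrightarrow> sqrt (j + - j)) (at_right 0)"
        by (intro tendsto_intros r1)
      hence "((\<lambda>h. sqrt (j + r1 h)) \<longlongrightarrow> 0) (at_right 0)"
        by simp
      moreover have "((\<lambda>h. sqrt (0 - r1 h)) \<longlongrightarrow> sqrt (0 - - j)) (at_right 0)"
        by (intro tendsto_intros r1)
      ultimately have "LIM h at_right 0. sqrt (0 - r1 h) / sqrt (j + r1 h) :> at_top"
        using jr1 assms by (intro LIM_at_top_divide[where a = "sqrt (0 - - j)"]) auto
      hence "((\<lambda>h. arctan (sqrt (0 - r1 h) / sqrt (j + r1 h))) \<longlongrightarrow> pi / 2) (at_right 0)"
        by (rule filterlim_compose[OF tendsto_arctan_at_top])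
      thus "((\<lambda>h. 2 * sqrt 8 * (j - r1 h) * arctan (sqrt (0 - r1 h) / sqrt (j + r1 h))) \<longlongrightarrow>
          2 * sqrt 8 * (j - (- j)) * (pi / 2)) (at_right 0)"
        by (intro tendsto_intros r1)
      show "\<forall>\<^sub>F h in at_right 0.
          2 * sqrt 8 * (j - r1 h) * arctan (sqrt (0 - r1 h) / sqrt (j + r1 h)) = ?c h"
        using near h_pos jr1
      proof eventually_elim
        case (elim h)
        have "h * (2 / sqrt (j + r1 h)) = 2 * sqrt 8 * (j - r1 h)"
          using near_homoclinic.h_left[OF elim(1,2)] elim(3) by (simp add: field_simps)
        thus ?case
          by (metis mult.assoc)
      qed
    qed
    show "\<forall>\<^sub>F h in at_right 0.
        ((\<lambda>p. h * (1 / sqrt (p - r1 h))) has_integral h * (2 * sqrt (0 - r1 h))) {r1 h..0}"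
      using near
    proof eventually_elim
      case (elim h)
      show ?case
        using near_homoclinic.left_moment_integral[OF elim, of 0] near_homoclinic.order(1)[OF elim]
        by (intro has_integral_mult_right) auto
    qed
    have "((\<lambda>h. h * (2 * sqrt (0 - r1 h))) \<longlongrightarrow> 0 * (2 * sqrt (0 - - j))) (at_right 0)"
      by (intro tendsto_intros r1)
    thus "((\<lambda>h. h * (2 * sqrt (0 - r1 h))) \<longlongrightarrow> 0) (at_right 0)"
      by simp
    show "\<forall>\<^sub>F h in at_right 0. (\<lambda>p. left_weight j (r1 h, p) * ?k h p) integrable_on {r1 h..0}"
      using near
    proof eventually_elim
      case (elim h)
      show ?case
        using near_homoclinic.integrand_absolutely_integrable(1)[OF elim]
        unfolding near_homoclinic.integrand_left[OF elim, abs_def]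
        by (rule set_lebesgue_integral_eq_integral)
    qed
  qed (rule r1)
  have limit_value: "left_weight j (- j, - j) * (2 * sqrt 8 * (j - (- j)) * (pi / 2)) = pi / 2"
  proof -
    have "left_weight j (- j, - j) = j / (2 * j * sqrt (8 * (4 * j\<^sup>2)))"
      by (simp add: left_weight_def power2_eq_square)
    also have "sqrt (8 * (4 * j\<^sup>2)) = sqrt 8 * (2 * j)"
      using assms unfolding real_sqrt_mult by simp
    finally show ?thesis
      using assms by (simp add: field_simps)
  qed
  have eq: "\<forall>\<^sub>F h in at_right 0.
      integral {r1 h..0} (\<lambda>p. left_weight j (r1 h, p) * ?k h p) =
      integral {r1 h..0} (phase_integrand j h (r1 h) (r2 h) (r3 h))"
    using near
    by eventually_elim
      (intro Henstock_Kurzweil_Integration.integral_cong near_homoclinic.integrand_left[symmetric])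
  show ?thesis
    using Lim_transform_eventually[OF lim eq] by (simp only: limit_value)
qed

text \<open>
  The limit mass is \<open>4 \<surd>j (\<pi> / 2)\<close> and the weight at \<open>(- j, j)\<close> is \<open>- 1 / (8 \<surd>j)\<close>.
\<close>

lemma right_part_tendsto:
  assumes "j > 0" and near: "\<forall>\<^sub>F h in at_right 0. near_homoclinic j h (r1 h) (r2 h) (r3 h)"
  shows "((\<lambda>h. integral {0..r2 h} (phase_integrand j h (r1 h) (r2 h) (r3 h))) \<longlongrightarrow> - (pi / 4)) (at_right 0)"
proof -
  note r1 = r1_tendsto[OF near]
  have h_pos: "\<forall>\<^sub>F h in at_right 0. h > (0::real)"
    by (simp add: eventually_at_right_less)
  let ?k = "\<lambda>h p. h * (1 / ((j - p) * sqrt ((r2 h - p) * (r3 h - p))))"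
  let ?E = "\<lambda>h. (2 * ((j - r2 h) * (r3 h - j)) / j + (j + r1 h)) / (r3 h - r2 h)"
  let ?c = "\<lambda>h. h * ((pi / 2 - arcsin (?E h)) / sqrt ((j - r2 h) * (r3 h - j)))"
  let ?\<mu> = "\<lambda>h. h / sqrt (r3 h - r2 h) * (2 * sqrt (r2 h - 0))"
  have lim: "((\<lambda>h. integral {0..r2 h} (\<lambda>p. right_weight j (r1 h, p) * ?k h p)) \<longlongrightarrow>
      right_weight j (- j, j) * (sqrt (8 * (j - (- j))) * (pi / 2 - arcsin 0))) (at_right 0)"
  proof (rule concentrated_integral_tendsto)
    show "compact (right_domain j)"
      by (rule compact_domains)
    show "continuous_on (right_domain j) (right_weight j)"
      using assms by (intro continuous_right_weight)
    show "(- j, j) \<in> right_domain j"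
      using assms by (simp add: right_domain_def)
    show "\<forall>\<^sub>F h in at_right 0. \<forall>p\<in>{0..r2 h}. (r1 h, p) \<in> right_domain j"
      using near by eventually_elim (auto intro: near_homoclinic.in_domains)
    show "\<forall>\<^sub>F h in at_right 0. \<forall>p\<in>{0..r2 h}.
        0 \<le> ?k h p \<and> \<bar>p - j\<bar> * ?k h p \<le> h / sqrt (r3 h - r2 h) * (1 / sqrt (r2 h - p))"
      using near h_pos
    proof eventually_elim
      case (elim h)
      note o = near_homoclinic.order(3)[OF elim(1)] near_homoclinic.r2_less[OF elim(1)]
      show ?case
      proof (intro ballI conjI)
        fix p assume p: "p \<in> {0..r2 h}"
        show "0 \<le> ?k h p"
          using p o elim(2) by simp
        have "\<bar>p - j\<bar> * ?k h p = h * (1 / (sqrt (r2 h - p) * sqrt (r3 h - p)))"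
          using p o by (simp add: real_sqrt_mult)
        also have "\<dots> \<le> h / sqrt (r3 h - r2 h) * (1 / sqrt (r2 h - p))"
        proof (cases "p = r2 h")
          case False
          hence "sqrt (r2 h - p) * sqrt (r3 h - r2 h) \<le> sqrt (r2 h - p) * sqrt (r3 h - p)"
            "0 < sqrt (r2 h - p) * sqrt (r3 h - r2 h)"
            using p o by (auto intro: mult_left_mono)
          hence "1 / (sqrt (r2 h - p) * sqrt (r3 h - p)) \<le> 1 / (sqrt (r2 h - p) * sqrt (r3 h - r2 h))"
            by (intro frac_le) auto
          hence "h * (1 / (sqrt (r2 h - p) * sqrt (r3 h - p))) \<le> h * (1 / (sqrt (r2 h - p) * sqrt (r3 h - r2 h)))"
            using elim(2) by (intro mult_left_mono) auto
          thus ?thesis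
            by (simp add: mult.commute)
        qed simp
        finally show "\<bar>p - j\<bar> * ?k h p \<le> h / sqrt (r3 h - r2 h) * (1 / sqrt (r2 h - p))" .
      qed
    qed
    show "\<forall>\<^sub>F h in at_right 0. (?k h has_integral ?c h) {0..r2 h}"
      using near
    proof eventually_elim
      case (elim h)
      show ?case
        using near_homoclinic.right_kernel_integral[OF elim, of 0] near_homoclinic.r2_pos[OF elim]
        by (intro has_integral_mult_right) auto
    qed
    show "(?c \<longlongrightarrow> sqrt (8 * (j - (- j))) * (pi / 2 - arcsin 0)) (at_right 0)"
    proof (rule Lim_transform_eventually)
      have "(?E \<longlongrightarrow> 0) (at_right 0)"
      proof (rule tendsto_sandwich)
        show "\<forall>\<^sub>F h in at_right 0. 0 \<le> ?E h"
          using near h_pos by eventually_elim (rule near_homoclinic.right_kernel_endpoint)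
        show "\<forall>\<^sub>F h in at_right 0. ?E h \<le> h * (1 / (j * sqrt (8 * j)) + sqrt j / (4 * j\<^sup>2))"
          using near h_pos by eventually_elim (rule near_homoclinic.right_kernel_endpoint)
        have "((\<lambda>h. h * (1 / (j * sqrt (8 * j)) + sqrt j / (4 * j\<^sup>2))) \<longlongrightarrow>
            0 * (1 / (j * sqrt (8 * j)) + sqrt j / (4 * j\<^sup>2))) (at_right 0)"
          by (intro tendsto_intros)
        thus "((\<lambda>h. h * (1 / (j * sqrt (8 * j)) + sqrt j / (4 * j\<^sup>2))) \<longlongrightarrow> 0) (at_right 0)"
          by simp
      qed simp
      hence "((\<lambda>h. arcsin (?E h)) \<longlongrightarrow> arcsin 0) (at_right 0)"
        by (intro isCont_tendsto_compose[of 0 arcsin] isCont_arcsin) auto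
      thus "((\<lambda>h. sqrt (8 * (j - r1 h)) * (pi / 2 - arcsin (?E h))) \<longlongrightarrow>
          sqrt (8 * (j - (- j))) * (pi / 2 - arcsin 0)) (at_right 0)"
        by (intro tendsto_intros r1)
      show "\<forall>\<^sub>F h in at_right 0. sqrt (8 * (j - r1 h)) * (pi / 2 - arcsin (?E h)) = ?c h"
        using near h_pos
      proof eventually_elim
        case (elim h)
        define D where "D = sqrt ((j - r2 h) * (r3 h - j))"
        have "D > 0"
          using near_homoclinic.r2_less[OF elim(1)] near_homoclinic.r3_gt[OF elim(1)]
          by (simp add: D_def)
        moreover have "h = sqrt (8 * (j - r1 h)) * D"
          using near_homoclinic.h_right[OF elim] by (simp only: D_def)
        ultimately have "h / D = sqrt (8 * (j - r1 h))"
          by (metis divide_eq_eq less_irrefl)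
        thus ?case
          unfolding D_def[symmetric] by (metis times_divide_eq_left times_divide_eq_right)
      qed
    qed
    show "\<forall>\<^sub>F h in at_right 0.
        ((\<lambda>p. h / sqrt (r3 h - r2 h) * (1 / sqrt (r2 h - p))) has_integral ?\<mu> h) {0..r2 h}"
      using near
    proof eventually_elim
      case (elim h)
      show ?case
        using near_homoclinic.right_moment_integral[OF elim, of 0] near_homoclinic.r2_pos[OF elim]
        by (intro has_integral_mult_right) auto
    qed
    show "(?\<mu> \<longlongrightarrow> 0) (at_right 0)"
    proof (rule tendsto_sandwich)
      show "\<forall>\<^sub>F h in at_right 0. 0 \<le> ?\<mu> h"
        using near h_pos
      proof eventually_elim
        case (elim h)
        show ?case
          using elim(2) near_homoclinic.order(3)[OF elim(1)] near_homoclinic.r2_pos[OF elim(1)]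
          by simp
      qed
      show "\<forall>\<^sub>F h in at_right 0. ?\<mu> h \<le> sqrt (8 * j * sqrt j * h)"
        using near h_pos
      proof eventually_elim
        case (elim h)
        note b = near_homoclinic.order(3)[OF elim(1)] near_homoclinic.r2_pos[OF elim(1)]
          near_homoclinic.r2_less[OF elim(1)] near_homoclinic.gap_ge(1)[OF elim]
        have "h\<^sup>2 / (r3 h - r2 h) \<le> h\<^sup>2 / (h / (2 * sqrt j))"
          using b elim(2) assms(1) by (intro divide_left_mono) auto
        also have "\<dots> = 2 * sqrt j * h"
          using elim(2) by (simp add: power2_eq_square)
        finally have "h\<^sup>2 / (r3 h - r2 h) * (4 * r2 h) \<le> (2 * sqrt j * h) * (4 * j)"
          using b elim(2) assms(1) by (intro mult_mono) auto
        moreover have "(?\<mu> h)\<^sup>2 = h\<^sup>2 / (r3 h - r2 h) * (4 * r2 h)"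
          using b by (simp add: power_mult_distrib power_divide)
        ultimately show ?case
          by (intro real_le_rsqrt) (simp add: algebra_simps)
      qed
      have "((\<lambda>h. sqrt (8 * j * sqrt j * h)) \<longlongrightarrow> sqrt (8 * j * sqrt j * 0)) (at_right 0)"
        by (intro tendsto_intros)
      thus "((\<lambda>h. sqrt (8 * j * sqrt j * h)) \<longlongrightarrow> 0) (at_right 0)"
        by simp
    qed simp
    show "\<forall>\<^sub>F h in at_right 0. (\<lambda>p. right_weight j (r1 h, p) * ?k h p) integrable_on {0..r2 h}"
      using near
    proof eventually_elim
      case (elim h)
      show ?case
        using near_homoclinic.integrand_absolutely_integrable(2)[OF elim]
        unfolding near_homoclinic.integrand_right[OF elim, abs_def]
        by (rule set_lebesgue_integral_eq_integral)
    qed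
  qed (rule r1)
  have limit_value: "right_weight j (- j, j) * (sqrt (8 * (j - (- j))) * (pi / 2 - arcsin 0)) = - (pi / 4)"
    using assms by (simp add: right_weight_def field_simps)
  have eq: "\<forall>\<^sub>F h in at_right 0.
      integral {0..r2 h} (\<lambda>p. right_weight j (r1 h, p) * ?k h p) =
      integral {0..r2 h} (phase_integrand j h (r1 h) (r2 h) (r3 h))"
    using near
    by eventually_elim
      (intro Henstock_Kurzweil_Integration.integral_cong near_homoclinic.integrand_right[symmetric])
  show ?thesis
    using Lim_transform_eventually[OF lim eq] by (simp only: limit_value)
qed

section \<open>The phase change over one traversal\<close>

context near_homoclinic
begin

lemma reduced_point:
  assumes "(w, h, p) \<in> reduced_space j"
  shows "w\<^sup>2 = 8 * (p - r1) * (r2 - p) * (r3 - p)" and "r1 \<le> p" and "p \<le> r2"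
    and "w\<^sup>2 + h\<^sup>2 = 8 * (j - p)\<^sup>2 * (j + p)" and "- j < p" and "p < j"
proof -
  have *: "w\<^sup>2 + h\<^sup>2 = 8 * (p\<^sup>2 - j\<^sup>2) * (p - j)"
    using assms reduced_curve by blast
  show "w\<^sup>2 + h\<^sup>2 = 8 * (j - p)\<^sup>2 * (j + p)"
    unfolding * by algebra
  hence "w\<^sup>2 = 8 * (p - j)\<^sup>2 * (p + j) - h\<^sup>2"
    by (simp add: power2_commute add.commute)
  thus "w\<^sup>2 = 8 * (p - r1) * (r2 - p) * (r3 - p)"
    unfolding factorization by algebra
  show "r1 \<le> p" "p \<le> r2"
    using assms reduced_curve by blast+
  thus "- j < p" "p < j"
    using r1_gt r2_less by linarith+
qed

text \<open>
  On a half where \<open>w\<close> has the constant sign \<open>\<sigma>\<close>, the equation for the phase says that \<open>\<theta>\<close> and \<open>\<sigma>\<close>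
  times the indefinite integral of the phase integrand, evaluated at \<open>p t\<close>, have the same
  derivative.  Both are continuous up to the turning points, so their difference is constant
  there as well.
\<close>

lemma phase_change_half:
  fixes \<sigma> :: real
  assumes "a < b" and \<sigma>: "\<sigma> = 1 \<or> \<sigma> = - 1"
    and curve: "\<And>t. t \<in> {a..b} \<Longrightarrow> (w t, h, p t) \<in> reduced_space j"
    and sign: "\<And>t. t \<in> {a<..<b} \<Longrightarrow> \<sigma> * w t > 0"
    and cont: "continuous_on {a..b} p" "continuous_on {a..b} \<theta>"
    and p: "\<And>t. t \<in> {a<..<b} \<Longrightarrow> (p has_real_derivative p' t) (at t)"
    and \<theta>: "\<And>t. t \<in> {a<..<b} \<Longrightarrow>
      (\<theta> has_real_derivative - h * p t / ((j\<^sup>2 - (p t)\<^sup>2) * w t) * p' t) (at t)"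
  shows "\<theta> b - \<theta> a = \<sigma> * (integral {r1..p b} integrand - integral {r1..p a} integrand)"
proof -
  define \<Phi> where "\<Phi> x = integral {r1..x} integrand" for x
  let ?D = "\<lambda>t. \<theta> t - \<sigma> * \<Phi> (p t)"
  have "?D b = ?D a"
  proof (rule DERIV_isconst_end[OF assms(1)])
    have "continuous_on {r1..r2} \<Phi>"
      unfolding \<Phi>_def by (rule indefinite_integral_continuous_1[OF integrand_integrable])
    hence "continuous_on {a..b} (\<lambda>t. \<Phi> (p t))"
      by (rule continuous_on_compose2[OF _ cont(1)]) (use curve reduced_point in fastforce)
    thus "continuous_on {a..b} ?D"
      by (intro continuous_intros cont)
    fix t assume "a < t" "t < b"
    hence t: "t \<in> {a<..<b}" "t \<in> {a..b}"
      by auto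
    note c = reduced_point[OF curve[OF t(2)]]
    have w: "w t \<noteq> 0"
      using sign[OF t(1)] by auto
    have "p t \<noteq> r1" "p t \<noteq> r2"
      using c(1) w by auto
    with c have pt: "p t \<in> {r1<..<r2}"
      by auto
    have "isCont integrand (p t)"
    proof -
      have "8 * (p t - r1) * (r2 - p t) * (r3 - p t) \<noteq> 0"
        unfolding c(1)[symmetric] using w by simp
      moreover have "j\<^sup>2 - (p t)\<^sup>2 \<noteq> 0"
        using c(5,6) by (auto simp: power2_eq_iff)
      ultimately show ?thesis
        unfolding phase_integrand_def by (intro continuous_intros) auto
    qed
    hence "(\<Phi> has_vector_derivative integrand (p t)) (at (p t) within {r1..r2})"
      unfolding \<Phi>_def
      using integral_has_vector_derivative_continuous_at[OF integrand_integrable, of "p t" "{}"] pt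
      by (simp add: continuous_at_imp_continuous_at_within)
    hence \<Phi>': "(\<Phi> has_real_derivative integrand (p t)) (at (p t))"
      using pt at_within_Icc_at[of r1 "p t" r2]
      by (simp add: has_real_derivative_iff_has_vector_derivative)
    have "sqrt (8 * (p t - r1) * (r2 - p t) * (r3 - p t)) = \<sigma> * w t"
      unfolding c(1)[symmetric] using sign[OF t(1)] \<sigma> by auto
    hence "\<sigma> * integrand (p t) = - h * p t / ((j\<^sup>2 - (p t)\<^sup>2) * w t)"
      unfolding phase_integrand_def using \<sigma> by auto
    hence "(?D has_real_derivative \<sigma> * integrand (p t) * p' t - \<sigma> * (integrand (p t) * p' t)) (at t)"
      using \<theta>[OF t(1)] DERIV_chain2[of \<Phi> "integrand (p t)" p t "p' t" UNIV, OF \<Phi>' p[OF t(1)]]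
      by (intro DERIV_diff DERIV_cmult) simp_all
    thus "(?D has_real_derivative 0) (at t)"
      by simp
  qed
  thus ?thesis
    unfolding \<Phi>_def by (simp add: right_diff_distrib)
qed

text \<open>
  On the first half \<open>p\<close> runs downwards with \<open>w > 0\<close>, on the second upwards with \<open>w < 0\<close>: the two
  signs cancel, so both halves contribute the same amount.
\<close>

lemma phase_change:
  assumes "phase_traversal \<kappa> j h r1 r2 t0 t1 t2 w p \<theta>"
  shows "\<theta> t2 - \<theta> t0 = - 2 * integral {r1..r2} integrand"
proof -
  have t: "t0 < t1" "t1 < t2" and ends: "p t0 = r2" "p t1 = r1" "p t2 = r2"
    and sign: "\<forall>t\<in>{t0<..<t1}. w t > 0" "\<forall>t\<in>{t1<..<t2}. w t < 0"
    and curve: "\<forall>t\<in>{t0..t2}. (w t, h, p t) \<in> reduced_space j"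
    and p: "\<forall>t\<in>{t0..t2}. (p has_real_derivative - (\<kappa> * w t / 2)) (at t within {t0..t2})"
    and cont: "continuous_on {t0..t2} \<theta>"
    and \<theta>: "\<forall>t\<in>{t0..t2}. w t \<noteq> 0 \<longrightarrow>
        (\<theta> has_real_derivative
           (- h * p t / ((j\<^sup>2 - (p t)\<^sup>2) * w t)) * (- (\<kappa> * w t / 2)))
        (at t within {t0..t2})"
    using assms unfolding phase_traversal_def one_traversal_def by auto
  have cont_p: "continuous_on {t0..t2} p"
    using p by (intro DERIV_continuous_on) blast
  have at: "at t within {t0..t2} = at t" if "t \<in> {t0<..<t2}" for t
    using that by (intro at_within_Icc_at) auto
  have p': "(p has_real_derivative - (\<kappa> * w t / 2)) (at t)" if "t \<in> {t0<..<t2}" for t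
    using p that unfolding at[OF that, symmetric] by auto
  have \<theta>': "(\<theta> has_real_derivative
      - h * p t / ((j\<^sup>2 - (p t)\<^sup>2) * w t) * (- (\<kappa> * w t / 2))) (at t)"
    if "t \<in> {t0<..<t2}" "w t \<noteq> 0" for t
    using \<theta> that unfolding at[OF that(1), symmetric] by auto
  have "\<theta> t1 - \<theta> t0 = 1 * (integral {r1..p t1} integrand - integral {r1..p t0} integrand)"
  proof (rule phase_change_half[where w = w and p' = "\<lambda>t. - (\<kappa> * w t / 2)"])
    have sub: "{t0..t1} \<subseteq> {t0..t2}" "{t0<..<t1} \<subseteq> {t0<..<t2}"
      using t by auto
    show "continuous_on {t0..t1} p" "continuous_on {t0..t1} \<theta>"
      by (rule continuous_on_subset[OF cont_p sub(1)] continuous_on_subset[OF cont sub(1)])+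
    show "(w t, h, p t) \<in> reduced_space j" if "t \<in> {t0..t1}" for t
      using curve sub that by blast
    fix t assume "t \<in> {t0<..<t1}"
    hence in_T: "t \<in> {t0<..<t2}" and w: "1 * w t > 0"
      using sub(2) sign(1) by auto
    show "1 * w t > 0"
      by (rule w)
    show "(p has_real_derivative - (\<kappa> * w t / 2)) (at t)"
      by (rule p'[OF in_T])
    show "(\<theta> has_real_derivative
        - h * p t / ((j\<^sup>2 - (p t)\<^sup>2) * w t) * (- (\<kappa> * w t / 2))) (at t)"
      by (rule \<theta>'[OF in_T]) (use w in auto)
  qed (use t in auto)
  moreover have "\<theta> t2 - \<theta> t1 = - 1 * (integral {r1..p t2} integrand - integral {r1..p t1} integrand)"
  proof (rule phase_change_half[where w = w and p' = "\<lambda>t. - (\<kappa> * w t / 2)"])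
    have sub: "{t1..t2} \<subseteq> {t0..t2}" "{t1<..<t2} \<subseteq> {t0<..<t2}"
      using t by auto
    show "continuous_on {t1..t2} p" "continuous_on {t1..t2} \<theta>"
      by (rule continuous_on_subset[OF cont_p sub(1)] continuous_on_subset[OF cont sub(1)])+
    show "(w t, h, p t) \<in> reduced_space j" if "t \<in> {t1..t2}" for t
      using curve sub that by blast
    fix t assume "t \<in> {t1<..<t2}"
    hence in_T: "t \<in> {t0<..<t2}" and w: "- 1 * w t > 0"
      using sub(2) sign(2) by auto
    show "- 1 * w t > 0"
      by (rule w)
    show "(p has_real_derivative - (\<kappa> * w t / 2)) (at t)"
      by (rule p'[OF in_T])
    show "(\<theta> has_real_derivative
        - h * p t / ((j\<^sup>2 - (p t)\<^sup>2) * w t) * (- (\<kappa> * w t / 2))) (at t)"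
      by (rule \<theta>'[OF in_T]) (use w in auto)
  qed (use t in auto)
  ultimately show ?thesis
    unfolding ends by simp
qed

end

section \<open>From the drift system to the phase equation\<close>

text \<open>
  A continuous angle inherits differentiability from its sine, because arcsine inverts the sine
  of a small increment.
\<close>

lemma continuous_angle_derivative:
  fixes \<theta> :: "real \<Rightarrow> real"
  assumes "t \<in> T" and cont: "continuous (at t within T) \<theta>"
    and sin: "((\<lambda>s. sin (\<theta> s - \<theta> t)) has_real_derivative D) (at t within T)"
  shows "(\<theta> has_real_derivative D) (at t within T)"
proof -
  have "(arcsin has_real_derivative 1) (at (sin (\<theta> t - \<theta> t)))"
    using DERIV_arcsin[of 0] by simp
  hence "((\<lambda>s. \<theta> t + arcsin (sin (\<theta> s - \<theta> t))) has_real_derivative 0 + 1 * D) (at t within T)"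
    by (intro DERIV_add DERIV_const DERIV_chain2[OF _ sin])
  hence "((\<lambda>s. \<theta> t + arcsin (sin (\<theta> s - \<theta> t))) has_real_derivative D) (at t within T)"
    by simp
  moreover have "\<forall>\<^sub>F s in at t within T. dist (\<theta> s) (\<theta> t) < pi / 2"
    using cont unfolding continuous_within by (rule tendstoD) simp
  hence "\<forall>\<^sub>F s in at t within T. \<theta> t + arcsin (sin (\<theta> s - \<theta> t)) = \<theta> s"
  proof eventually_elim
    case (elim s)
    hence "\<bar>\<theta> s - \<theta> t\<bar> < pi / 2"
      by (simp add: dist_real_def)
    hence "arcsin (sin (\<theta> s - \<theta> t)) = \<theta> s - \<theta> t"
      by (intro arcsin_sin) linarith+
    thus ?case
      by simp
  qed
  ultimately show ?thesis
    unfolding has_field_derivative_def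
    by (rule has_derivative_transform_eventually) (use assms in auto)
qed

lemma level_set_iff:
  "(x, y) \<in> level_set j \<longleftrightarrow>
     j \<ge> 0 \<and> (y$1)\<^sup>2 + (y$2)\<^sup>2 + (y$3)\<^sup>2 = j\<^sup>2 \<and> (x$1)\<^sup>2 + (x$2)\<^sup>2 = 2 * (j - y$3)"
proof -
  have "(norm y)\<^sup>2 = (y$1)\<^sup>2 + (y$2)\<^sup>2 + (y$3)\<^sup>2"
    unfolding power2_norm_eq_inner inner_vec_def by (simp add: sum_3 power2_eq_square)
  moreover have "(norm x)\<^sup>2 = (x$1)\<^sup>2 + (x$2)\<^sup>2"
    unfolding power2_norm_eq_inner inner_vec_def by (simp add: sum_2 power2_eq_square)
  moreover have "norm y = j \<longleftrightarrow> j \<ge> 0 \<and> (norm y)\<^sup>2 = j\<^sup>2"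
    using norm_ge_zero[of y] by (auto simp: power2_eq_iff_nonneg)
  moreover have "- (1 / 2) * N - z = - j \<longleftrightarrow> N = 2 * (j - z)" for N z :: real
    by (auto simp: diff_divide_distrib)
  ultimately show ?thesis
    unfolding level_set_def by simp
qed

lemma rotated_lift:
  "rotate_state \<theta> (lift j h w p) =
     (let q = sqrt (j\<^sup>2 - p\<^sup>2) in
       (vector [cos \<theta> * (h / (2 * q)) - sin \<theta> * (- w / (2 * q)),
                sin \<theta> * (h / (2 * q)) + cos \<theta> * (- w / (2 * q))],
        vector [cos \<theta> * q, sin \<theta> * q, p]))"
  by (simp add: rotate_state_def lift_def Let_def)

lemma level_set_reduced:
  assumes "s \<in> level_set j"
  shows "(w1 s, w2 s, pi3 s) \<in> reduced_space j"
proof -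
  obtain x y where s: "s = (x, y)"
    by (cases s)
  have y: "j \<ge> 0" "(y$1)\<^sup>2 + (y$2)\<^sup>2 = j\<^sup>2 - (y$3)\<^sup>2" and x: "(x$1)\<^sup>2 + (x$2)\<^sup>2 = 2 * (j - y$3)"
    using assms unfolding s level_set_iff by auto
  have "(w1 s)\<^sup>2 + (w2 s)\<^sup>2 = 4 * ((x$1)\<^sup>2 + (x$2)\<^sup>2) * ((y$1)\<^sup>2 + (y$2)\<^sup>2)"
    unfolding s w1_def w2_def prod.case by algebra
  also have "\<dots> = 8 * ((pi3 s)\<^sup>2 - j\<^sup>2) * (pi3 s - j)"
    unfolding x y s pi3_def prod.case by algebra
  finally have "(w1 s)\<^sup>2 + (w2 s)\<^sup>2 = 8 * ((pi3 s)\<^sup>2 - j\<^sup>2) * (pi3 s - j)" .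
  moreover have "(y$3)\<^sup>2 \<le> j\<^sup>2"
    using y(2) sum_power2_ge_zero[of "y$1" "y$2"] by linarith
  hence "\<bar>y$3\<bar> \<le> j"
    using y(1) by (metis abs_le_square_iff abs_of_nonneg)
  ultimately show ?thesis
    unfolding reduced_space_def by (auto simp: s pi3_def)
qed

lemma drift_components:
  fixes \<gamma> :: "real \<Rightarrow> state"
  assumes "(\<gamma> has_vector_derivative drift_field \<kappa> a (\<gamma> t)) (at t within T)"
  defines "x \<equiv> \<lambda>i t. fst (\<gamma> t) $ i" and "y \<equiv> \<lambda>i t. snd (\<gamma> t) $ i"
  shows "(x 1 has_real_derivative \<kappa> * y 2 t) (at t within T)"
    and "(x 2 has_real_derivative - \<kappa> * y 1 t) (at t within T)"
    and "(y 1 has_real_derivative - \<kappa> * x 2 t * y 3 t + a * y 2 t) (at t within T)"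
    and "(y 2 has_real_derivative \<kappa> * x 1 t * y 3 t - a * y 1 t) (at t within T)"
    and "(y 3 has_real_derivative \<kappa> * (y 1 t * x 2 t - y 2 t * x 1 t)) (at t within T)"
proof -
  have x: "(x i has_real_derivative fst (drift_field \<kappa> a (\<gamma> t)) $ i) (at t within T)" for i
    unfolding x_def has_real_derivative_iff_has_vector_derivative
    by (rule bounded_linear.has_vector_derivative[OF _ assms(1)])
       (intro bounded_linear_compose[OF bounded_linear_vec_nth bounded_linear_fst])
  have y: "(y i has_real_derivative snd (drift_field \<kappa> a (\<gamma> t)) $ i) (at t within T)" for i
    unfolding y_def has_real_derivative_iff_has_vector_derivative
    by (rule bounded_linear.has_vector_derivative[OF _ assms(1)])
       (intro bounded_linear_compose[OF bounded_linear_vec_nth bounded_linear_snd])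
  show "(x 1 has_real_derivative \<kappa> * y 2 t) (at t within T)"
    and "(x 2 has_real_derivative - \<kappa> * y 1 t) (at t within T)"
    and "(y 1 has_real_derivative - \<kappa> * x 2 t * y 3 t + a * y 2 t) (at t within T)"
    and "(y 2 has_real_derivative \<kappa> * x 1 t * y 3 t - a * y 1 t) (at t within T)"
    and "(y 3 has_real_derivative \<kappa> * (y 1 t * x 2 t - y 2 t * x 1 t)) (at t within T)"
    using x[of 1] x[of 2] y[of 1] y[of 2] y[of 3]
    by (simp_all add: drift_field_def x_def y_def case_prod_unfold)
qed

text \<open>
  From \<open>(\<pi>\<^sub>1, \<pi>\<^sub>2) = q (cos \<theta>, sin \<theta>)\<close> one gets
  \<open>\<theta>' = (\<pi>\<^sub>1 \<pi>\<^sub>2' - \<pi>\<^sub>2 \<pi>\<^sub>1') / q\<^sup>2 = \<kappa> h \<pi>\<^sub>3 / (2 q\<^sup>2) - a\<close>, where \<open>q\<^sup>2 = j\<^sup>2 - \<pi>\<^sub>3\<^sup>2\<close>; this is the phase equation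
  only because \<open>a = 0\<close>.
\<close>

lemma (in near_homoclinic) drift_traversal_phase:
  assumes "drift_traversal \<kappa> a j h r1 r2 t0 t1 t2 \<gamma> \<theta>"
  shows "phase_traversal \<kappa> j h r1 r2 t0 t1 t2 (w1 \<circ> \<gamma>) (pi3 \<circ> \<gamma>) \<theta>"
proof -
  let ?T = "{t0..t2}"
  have trav: "one_traversal r1 r2 t0 t1 t2 (w1 \<circ> \<gamma>) (pi3 \<circ> \<gamma>)"
    and level: "\<And>t. t \<in> ?T \<Longrightarrow> \<gamma> t \<in> level_set j" "\<And>t. t \<in> ?T \<Longrightarrow> w2 (\<gamma> t) = h"
    and ode: "\<And>t. t \<in> ?T \<Longrightarrow> (\<gamma> has_vector_derivative drift_field \<kappa> a (\<gamma> t)) (at t within ?T)"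
    and cont: "continuous_on ?T \<theta>"
    and angle: "\<And>t. t \<in> ?T \<Longrightarrow> \<gamma> t = rotate_state (\<theta> t) (lift j h (w1 (\<gamma> t)) (pi3 (\<gamma> t)))"
    using assms unfolding drift_traversal_def by auto
  define x where "x i t = fst (\<gamma> t) $ i" for i t
  define y where "y i t = snd (\<gamma> t) $ i" for i t
  note deriv = drift_components[OF ode, folded x_def y_def]
  have w1: "w1 (\<gamma> t) = 2 * (x 1 t * y 2 t - x 2 t * y 1 t)" for t
    by (simp add: w1_def x_def y_def case_prod_unfold)
  have w2: "w2 (\<gamma> t) = 2 * (x 1 t * y 1 t + x 2 t * y 2 t)" for t
    by (simp add: w2_def x_def y_def case_prod_unfold)
  have pi3: "pi3 (\<gamma> t) = y 3 t" for t
    by (simp add: pi3_def y_def case_prod_unfold)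
  have reduced: "(w1 (\<gamma> t), h, y 3 t) \<in> reduced_space j" if "t \<in> ?T" for t
    using level_set_reduced[OF level(1)[OF that]] level(2)[OF that] by (simp add: pi3)
  \<comment> \<open>Along the flow \<open>dw\<^sub>2/dt = a w\<^sub>1\<close>, and \<open>w\<^sub>1\<close> does not vanish identically.\<close>
  have a: "a = 0"
  proof -
    define t where "t = (t0 + t1) / 2"
    have t: "t0 < t" "t < t1" "t \<in> {t0<..<t2}" "t \<in> ?T" "w1 (\<gamma> t) > 0"
      using trav by (auto simp: one_traversal_def t_def field_simps)
    have at: "at t within ?T = at t"
      using t by (intro at_within_Icc_at) auto
    note d = deriv[OF t(4), unfolded at]
    have "((\<lambda>t. 2 * (x 1 t * y 1 t + x 2 t * y 2 t)) has_real_derivative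
        2 * ((\<kappa> * y 2 t * y 1 t + (- \<kappa> * x 2 t * y 3 t + a * y 2 t) * x 1 t) +
             (- \<kappa> * y 1 t * y 2 t + (\<kappa> * x 1 t * y 3 t - a * y 1 t) * x 2 t))) (at t)"
      by (intro DERIV_cmult DERIV_add DERIV_mult d)
    moreover have "2 * ((\<kappa> * y 2 t * y 1 t + (- \<kappa> * x 2 t * y 3 t + a * y 2 t) * x 1 t) +
             (- \<kappa> * y 1 t * y 2 t + (\<kappa> * x 1 t * y 3 t - a * y 1 t) * x 2 t)) = a * w1 (\<gamma> t)"
      unfolding w1 by algebra
    ultimately have "((\<lambda>t. w2 (\<gamma> t)) has_real_derivative a * w1 (\<gamma> t)) (at t)"
      unfolding w2 by simp
    moreover have "((\<lambda>t. w2 (\<gamma> t)) has_real_derivative 0) (at t)"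
    proof (rule has_field_derivative_transform_within_open[where S = "{t0<..<t2}"])
      show "((\<lambda>_. h) has_real_derivative 0) (at t)"
        by simp
    qed (use t level(2) in auto)
    ultimately have "a * w1 (\<gamma> t) = 0"
      by (rule DERIV_unique)
    thus ?thesis
      using t(5) by simp
  qed
  have phase: "(\<theta> has_real_derivative \<kappa> * h * y 3 t / (2 * (j\<^sup>2 - (y 3 t)\<^sup>2))) (at t within ?T)"
    if t: "t \<in> ?T" for t
  proof (rule continuous_angle_derivative[OF t])
    show "continuous (at t within ?T) \<theta>"
      using cont t by (simp add: continuous_on_eq_continuous_within)
    define q where "q s = sqrt (j\<^sup>2 - (y 3 s)\<^sup>2)" for s
    have q: "q s > 0" "(q s)\<^sup>2 = j\<^sup>2 - (y 3 s)\<^sup>2" if "s \<in> ?T" for s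
    proof -
      have "\<bar>y 3 s\<bar> < \<bar>j\<bar>"
        using reduced_point(5,6)[OF reduced[OF that]] by linarith
      hence "(y 3 s)\<^sup>2 < j\<^sup>2"
        by (metis abs_ge_zero power2_abs power_strict_mono zero_less_numeral)
      thus "q s > 0" "(q s)\<^sup>2 = j\<^sup>2 - (y 3 s)\<^sup>2"
        by (simp_all add: q_def)
    qed
    have polar: "y 1 s = cos (\<theta> s) * q s" "y 2 s = sin (\<theta> s) * q s" if "s \<in> ?T" for s
    proof -
      have v: "snd (\<gamma> s) = vector [cos (\<theta> s) * q s, sin (\<theta> s) * q s, y 3 s]"
        by (subst angle[OF that]) (simp add: rotated_lift Let_def q_def pi3)
      thus "y 1 s = cos (\<theta> s) * q s" "y 2 s = sin (\<theta> s) * q s"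
        using arg_cong[OF v, of "\<lambda>v. v $ 1"] arg_cong[OF v, of "\<lambda>v. v $ 2"]
        by (simp_all add: y_def[of 1] y_def[of 2])
    qed
    note d = deriv[OF t, unfolded a]
    obtain q' where q': "(q has_real_derivative q') (at t within ?T)"
    proof -
      have "j\<^sup>2 - (y 3 t)\<^sup>2 > 0"
        using q[OF t] by (metis zero_less_power)
      hence "\<exists>q'. ((\<lambda>s. sqrt (j\<^sup>2 - (y 3 s)\<^sup>2)) has_real_derivative q') (at t within ?T)"
        using d(5) by (intro exI) (auto intro!: derivative_eq_intros)
      thus thesis
        using that by (auto simp: q_def[abs_def])
    qed
    \<comment> \<open>\<open>?N s\<close> is \<open>q s * q t * sin (\<theta> s - \<theta> t)\<close>, and vanishes at \<open>s = t\<close>.\<close>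
    let ?N = "\<lambda>s. y 2 s * y 1 t - y 1 s * y 2 t"
    have "(?N has_real_derivative
        (\<kappa> * x 1 t * y 3 t - 0 * y 1 t) * y 1 t - (- \<kappa> * x 2 t * y 3 t + 0 * y 2 t) * y 2 t) (at t within ?T)"
      by (intro DERIV_diff DERIV_cmult_right d)
    moreover have "(\<kappa> * x 1 t * y 3 t - 0 * y 1 t) * y 1 t - (- \<kappa> * x 2 t * y 3 t + 0 * y 2 t) * y 2 t =
        \<kappa> * h * y 3 t / 2"
      unfolding level(2)[OF t, unfolded w2, symmetric] by algebra
    ultimately have N: "(?N has_real_derivative \<kappa> * h * y 3 t / 2) (at t within ?T)"
      by (simp only:)
    have "((\<lambda>s. ?N s / (q s * q t)) has_real_derivative
        (\<kappa> * h * y 3 t / 2 * (q t * q t) - ?N t * (q' * q t)) / ((q t * q t) * (q t * q t))) (at t within ?T)"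
      by (rule DERIV_divide[OF N DERIV_cmult_right[OF q']]) (use q(1)[OF t] in simp)
    moreover have "(\<kappa> * h * y 3 t / 2 * (q t * q t) - ?N t * (q' * q t)) / ((q t * q t) * (q t * q t)) =
        \<kappa> * h * y 3 t / (2 * (j\<^sup>2 - (y 3 t)\<^sup>2))"
      unfolding q(2)[OF t, symmetric] using q(1)[OF t] by (simp add: power2_eq_square)
    ultimately have "((\<lambda>s. ?N s / (q s * q t)) has_real_derivative
        \<kappa> * h * y 3 t / (2 * (j\<^sup>2 - (y 3 t)\<^sup>2))) (at t within ?T)"
      by simp
    thus "((\<lambda>s. sin (\<theta> s - \<theta> t)) has_real_derivative
        \<kappa> * h * y 3 t / (2 * (j\<^sup>2 - (y 3 t)\<^sup>2))) (at t within ?T)"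
    proof (rule has_field_derivative_transform_within[OF _ zero_less_one t])
      fix s assume s: "s \<in> ?T"
      show "?N s / (q s * q t) = sin (\<theta> s - \<theta> t)"
        using q(1)[OF s] q(1)[OF t] unfolding polar[OF s] polar[OF t] sin_diff
        by (simp add: field_simps)
    qed
  qed
  show ?thesis
    unfolding phase_traversal_def comp_def pi3
  proof (intro conjI ballI impI)
    show "one_traversal r1 r2 t0 t1 t2 (\<lambda>t. w1 (\<gamma> t)) (y 3)"
      using trav by (simp add: comp_def pi3)
    show "(w1 (\<gamma> t), h, y 3 t) \<in> reduced_space j" if "t \<in> ?T" for t
      using reduced that .
    show "(y 3 has_real_derivative - (\<kappa> * w1 (\<gamma> t) / 2)) (at t within ?T)" if "t \<in> ?T" for t
    proof -
      have "\<kappa> * (y 1 t * x 2 t - y 2 t * x 1 t) = - (\<kappa> * w1 (\<gamma> t) / 2)"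
        unfolding w1 by algebra
      thus ?thesis
        using deriv(5)[OF that] by (simp only:)
    qed
    show "continuous_on ?T \<theta>"
      by (rule cont)
    show "(\<theta> has_real_derivative
        - h * y 3 t / ((j\<^sup>2 - (y 3 t)\<^sup>2) * w1 (\<gamma> t)) * - (\<kappa> * w1 (\<gamma> t) / 2)) (at t within ?T)"
      if "t \<in> ?T" "w1 (\<gamma> t) \<noteq> 0" for t
    proof -
      have "- h * y 3 t / ((j\<^sup>2 - (y 3 t)\<^sup>2) * w1 (\<gamma> t)) * - (\<kappa> * w1 (\<gamma> t) / 2) =
          \<kappa> * h * y 3 t / (2 * (j\<^sup>2 - (y 3 t)\<^sup>2))"
        using that(2) by (simp add: ac_simps)
      thus ?thesis
        using phase[OF that(1)] by (simp only:)
    qed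
  qed
qed

section \<open>Existence of a traversal\<close>

text \<open>
  Separation of variables: \<open>T\<close> is an antiderivative of \<open>1 / g\<close> and \<open>S\<close> its inverse.
\<close>

lemma autonomous_flow:
  fixes g :: "real \<Rightarrow> real"
  assumes cont: "continuous_on {a..b} g" and pos: "\<And>s. s \<in> {a..b} \<Longrightarrow> g s > 0"
  obtains T S :: "real \<Rightarrow> real" where
    "strict_mono_on {a..b} T" "continuous_on {a..b} T"
    "\<And>s. s \<in> {a..b} \<Longrightarrow> S (T s) = s"
    "\<And>s. s \<in> {a<..<b} \<Longrightarrow> (S has_real_derivative g s) (at (T s))"
proof -
  have "continuous_on {a..b} (\<lambda>s. 1 / g s)"
    using pos by (intro continuous_intros cont) (auto simp: less_imp_neq[symmetric])
  then obtain T where T': "\<And>s. s \<in> {a..b} \<Longrightarrow> (T has_vector_derivative 1 / g s) (at s within {a..b})"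
    using antiderivative_continuous by blast
  hence T: "(T has_real_derivative 1 / g s) (at s within {a..b})" if "s \<in> {a..b}" for s
    using that by (simp add: has_real_derivative_iff_has_vector_derivative)
  have contT: "continuous_on {a..b} T"
    using T by (rule DERIV_continuous_on)
  have T_at: "(T has_real_derivative 1 / g s) (at s)" if "s \<in> {a<..<b}" for s
    using T[of s] at_within_Icc_at[of a s b] that by auto
  have mono: "strict_mono_on {a..b} T"
  proof (rule strict_mono_onI)
    fix u v assume uv: "u \<in> {a..b}" "v \<in> {a..b}" "u < v"
    show "T u < T v"
    proof (rule DERIV_pos_imp_increasing_open[OF uv(3)])
      show "\<exists>y. (T has_real_derivative y) (at x) \<and> 0 < y" if "u < x" "x < v" for x
        using T_at[of x] pos[of x] uv that by (intro exI[of _ "1 / g x"]) auto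
      show "continuous_on {u..v} T"
        using uv by (intro continuous_on_subset[OF contT]) auto
    qed
  qed
  define S where "S = the_inv_into {a..b} T"
  have inj: "inj_on T {a..b}"
    using mono by (rule strict_mono_on_imp_inj_on)
  hence S: "S (T s) = s" if "s \<in> {a..b}" for s
    unfolding S_def using that by (rule the_inv_into_f_f)
  have "(S has_real_derivative g s) (at (T s))" if s: "s \<in> {a<..<b}" for s
  proof -
    have gs: "g s > 0"
      using pos s by auto
    have "(S has_derivative (*) (g s)) (at (T s))"
    proof (rule has_derivative_inverse_strong[where f = T and g = S and x = s and
            f' = "(*) (1 / g s)" and S = "{a<..<b}"])
      show "(T has_derivative (*) (1 / g s)) (at s)"
        using T_at[OF s] by (simp add: has_field_derivative_def)
      show "continuous_on {a<..<b} T"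
        using contT by (rule continuous_on_subset) auto
      show "(*) (1 / g s) \<circ> (*) (g s) = id"
        using gs by (auto simp: fun_eq_iff)
    qed (use s S in auto)
    thus ?thesis
      by (simp add: has_field_derivative_def)
  qed
  with mono contT S that show ?thesis
    by blast
qed

lemma has_vector_derivative_vector_2:
  fixes f g :: "real \<Rightarrow> real"
  assumes "(f has_real_derivative f') (at t within T)" "(g has_real_derivative g') (at t within T)"
  shows "((\<lambda>t. vector [f t, g t] :: real ^ 2) has_vector_derivative vector [f', g']) (at t within T)"
proof -
  have expand: "(vector [u, v] :: real ^ 2) = u *\<^sub>R axis 1 1 + v *\<^sub>R axis 2 1" for u v
    by (simp add: vec_eq_iff forall_2 axis_def)
  have "((\<lambda>t. f t *\<^sub>R axis 1 1 + g t *\<^sub>R axis 2 1 :: real ^ 2) has_vector_derivative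
      f' *\<^sub>R axis 1 1 + g' *\<^sub>R axis 2 1) (at t within T)"
    using assms unfolding has_real_derivative_iff_has_vector_derivative
    by (intro has_vector_derivative_add bounded_linear.has_vector_derivative[OF bounded_linear_scaleR_left])
  thus ?thesis
    unfolding expand .
qed

lemma has_vector_derivative_vector_3:
  fixes f g k :: "real \<Rightarrow> real"
  assumes "(f has_real_derivative f') (at t within T)" "(g has_real_derivative g') (at t within T)"
    "(k has_real_derivative k') (at t within T)"
  shows "((\<lambda>t. vector [f t, g t, k t] :: real ^ 3) has_vector_derivative vector [f', g', k']) (at t within T)"
proof -
  have expand: "(vector [u, v, w] :: real ^ 3) = u *\<^sub>R axis 1 1 + v *\<^sub>R axis 2 1 + w *\<^sub>R axis 3 1" for u v w
    by (simp add: vec_eq_iff forall_3 axis_def)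
  have "((\<lambda>t. f t *\<^sub>R axis 1 1 + g t *\<^sub>R axis 2 1 + k t *\<^sub>R axis 3 1 :: real ^ 3) has_vector_derivative
      f' *\<^sub>R axis 1 1 + g' *\<^sub>R axis 2 1 + k' *\<^sub>R axis 3 1) (at t within T)"
    using assms unfolding has_real_derivative_iff_has_vector_derivative
    by (intro has_vector_derivative_add bounded_linear.has_vector_derivative[OF bounded_linear_scaleR_left])
  thus ?thesis
    unfolding expand .
qed

text \<open>
  Reconstruction: a solution of the reduced equations, with the phase equation in the form that
  is regular at the turning points, lifts to a solution of the drift system.  In the frame rotated
  by \<open>\<theta>\<close> the position is \<open>(u, v)\<close> and the drift equations read \<open>u' = \<theta>' v\<close> and
  \<open>v' = - \<kappa> q - \<theta>' u\<close>, with \<open>q\<close> the length of \<open>(\<pi>\<^sub>1, \<pi>\<^sub>2)\<close>.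
\<close>

lemma lifted_motion:
  fixes w p \<theta> :: "real \<Rightarrow> real"
  assumes pt: "- j < p t" "p t < j"
    and curve: "(w t)\<^sup>2 + h\<^sup>2 = 8 * (j - p t)\<^sup>2 * (j + p t)"
    and p: "(p has_real_derivative - (\<kappa> * w t / 2)) (at t within T)"
    and w: "(w has_real_derivative - \<kappa> / 4 * (16 * (p t - j) * (p t + j) + 8 * (p t - j)\<^sup>2)) (at t within T)"
    and \<theta>: "(\<theta> has_real_derivative \<kappa> * h * p t / (2 * (j\<^sup>2 - (p t)\<^sup>2))) (at t within T)"
  defines "\<gamma> \<equiv> \<lambda>t. rotate_state (\<theta> t) (lift j h (w t) (p t))"
  shows "(\<gamma> has_vector_derivative drift_field \<kappa> 0 (\<gamma> t)) (at t within T)"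
proof -
  define q where "q s = sqrt (j\<^sup>2 - (p s)\<^sup>2)" for s
  define u where "u s = h / (2 * q s)" for s
  define v where "v s = - w s / (2 * q s)" for s
  define \<omega> where "\<omega> = \<kappa> * h * p t / (2 * (j\<^sup>2 - (p t)\<^sup>2))"
  have "j\<^sup>2 - (p t)\<^sup>2 = (j - p t) * (j + p t)"
    by algebra
  hence q2_pos: "j\<^sup>2 - (p t)\<^sup>2 > 0"
    using pt by simp
  hence q: "q t > 0" "(q t)\<^sup>2 = j\<^sup>2 - (p t)\<^sup>2"
    by (simp_all add: q_def)
  have \<omega>: "\<omega> = \<kappa> * h * p t / (2 * (q t)\<^sup>2)"
    by (simp add: \<omega>_def q)
  have q': "(q has_real_derivative - \<kappa> * p t * v t) (at t within T)"
  proof -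
    have "((\<lambda>s. j\<^sup>2 - (p s)\<^sup>2) has_real_derivative 0 - 2 * p t * - (\<kappa> * w t / 2)) (at t within T)"
      using p by (auto intro!: derivative_eq_intros)
    hence "(q has_real_derivative
        inverse (sqrt (j\<^sup>2 - (p t)\<^sup>2)) / 2 * (0 - 2 * p t * - (\<kappa> * w t / 2))) (at t within T)"
      unfolding q_def[abs_def]
      by (rule DERIV_chain2[where f = sqrt and g = "\<lambda>s. j\<^sup>2 - (p s)\<^sup>2" and x = t,
            OF DERIV_real_sqrt[OF q2_pos]])
    moreover have "inverse (sqrt (j\<^sup>2 - (p t)\<^sup>2)) / 2 * (0 - 2 * p t * - (\<kappa> * w t / 2)) = - \<kappa> * p t * v t"
      unfolding v_def q_def[symmetric] using q(1) by (simp add: field_simps)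
    ultimately show ?thesis
      by (simp only:)
  qed
  have u': "(u has_real_derivative \<omega> * v t) (at t within T)"
  proof -
    have "(u has_real_derivative
        (0 * (2 * q t) - h * (2 * (- \<kappa> * p t * v t))) / ((2 * q t) * (2 * q t))) (at t within T)"
      unfolding u_def[abs_def] using q(1) by (intro DERIV_divide DERIV_const DERIV_cmult q') auto
    moreover have "(0 * (2 * q t) - h * (2 * (- \<kappa> * p t * v t))) / ((2 * q t) * (2 * q t)) = \<omega> * v t"
      unfolding \<omega> using q(1) by (simp add: field_simps power2_eq_square)
    ultimately show ?thesis
      by (simp only:)
  qed
  have v': "(v has_real_derivative - \<kappa> * q t - \<omega> * u t) (at t within T)"
  proof -
    \<comment> \<open>The derivative of \<open>w\<close>, as differentiating the equation of the curve gives it.\<close>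
    define W where "W = - \<kappa> / 4 * (16 * (p t - j) * (p t + j) + 8 * (p t - j)\<^sup>2)"
    have W: "W = 4 * \<kappa> * (q t)\<^sup>2 - 2 * \<kappa> * (j - p t)\<^sup>2"
      unfolding W_def q(2) by (simp add: power2_eq_square algebra_simps)
    have "(v has_real_derivative
        (- W * (2 * q t) - (- w t) * (2 * (- \<kappa> * p t * v t))) / ((2 * q t) * (2 * q t))) (at t within T)"
      unfolding v_def[abs_def] using q(1) w[folded W_def]
      by (intro DERIV_divide DERIV_minus DERIV_cmult q'[unfolded v_def]) auto
    moreover have "(- W * (2 * q t) - (- w t) * (2 * (- \<kappa> * p t * v t))) / ((2 * q t) * (2 * q t)) =
        - \<kappa> * q t - \<omega> * u t"
    proof -
      have "(- W * (2 * q t) - (- w t) * (2 * (- \<kappa> * p t * v t))) / ((2 * q t) * (2 * q t)) + \<omega> * u t =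
          (- 2 * W * (q t)\<^sup>2 + \<kappa> * p t * ((w t)\<^sup>2 + h\<^sup>2)) / (4 * (q t)\<^sup>2 * q t)"
        unfolding \<omega> v_def u_def using q(1) by (simp add: field_simps power2_eq_square)
      also have "- 2 * W * (q t)\<^sup>2 + \<kappa> * p t * ((w t)\<^sup>2 + h\<^sup>2) = - \<kappa> * (4 * (q t)\<^sup>2 * (q t)\<^sup>2)"
        unfolding W curve q(2) by algebra
      also have "- \<kappa> * (4 * (q t)\<^sup>2 * (q t)\<^sup>2) / (4 * (q t)\<^sup>2 * q t) = - \<kappa> * q t"
        using q(1) by (simp add: power2_eq_square)
      finally show ?thesis
        by (simp only: eq_diff_eq)
    qed
    ultimately show ?thesis
      by (simp only:)
  qed
  note \<theta>' = \<theta>[folded \<omega>_def]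
  have cos': "((\<lambda>s. cos (\<theta> s)) has_real_derivative - sin (\<theta> t) * \<omega>) (at t within T)"
    by (rule DERIV_chain2[OF DERIV_cos \<theta>'])
  have sin': "((\<lambda>s. sin (\<theta> s)) has_real_derivative cos (\<theta> t) * \<omega>) (at t within T)"
    by (rule DERIV_chain2[OF DERIV_sin \<theta>'])
  have qu: "q t * \<omega> = \<kappa> * p t * u t"
    unfolding \<omega> u_def using q(1) by (simp add: field_simps power2_eq_square)
  have qv: "\<kappa> * (q t * v t) = - (\<kappa> * w t / 2)"
    unfolding v_def using q(1) by simp
  have trig: "(sin (\<theta> t))\<^sup>2 + (cos (\<theta> t))\<^sup>2 = 1"
    by simp
  have \<gamma>: "\<gamma> = (\<lambda>s. (vector [cos (\<theta> s) * u s - sin (\<theta> s) * v s, sin (\<theta> s) * u s + cos (\<theta> s) * v s],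
      vector [cos (\<theta> s) * q s, sin (\<theta> s) * q s, p s]))"
    by (simp add: \<gamma>_def rotated_lift Let_def q_def u_def v_def)
  have field: "drift_field \<kappa> 0 (\<gamma> t) =
     (vector [- sin (\<theta> t) * \<omega> * u t + \<omega> * v t * cos (\<theta> t) -
                (cos (\<theta> t) * \<omega> * v t + (- \<kappa> * q t - \<omega> * u t) * sin (\<theta> t)),
              cos (\<theta> t) * \<omega> * u t + \<omega> * v t * sin (\<theta> t) +
                (- sin (\<theta> t) * \<omega> * v t + (- \<kappa> * q t - \<omega> * u t) * cos (\<theta> t))],
      vector [- sin (\<theta> t) * \<omega> * q t + - \<kappa> * p t * v t * cos (\<theta> t),
              cos (\<theta> t) * \<omega> * q t + - \<kappa> * p t * v t * sin (\<theta> t),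
              - (\<kappa> * w t / 2)])"
  proof -
    have "- sin (\<theta> t) * \<omega> * u t + \<omega> * v t * cos (\<theta> t) -
        (cos (\<theta> t) * \<omega> * v t + (- \<kappa> * q t - \<omega> * u t) * sin (\<theta> t)) = \<kappa> * (sin (\<theta> t) * q t)"
      by algebra
    moreover have "cos (\<theta> t) * \<omega> * u t + \<omega> * v t * sin (\<theta> t) +
        (- sin (\<theta> t) * \<omega> * v t + (- \<kappa> * q t - \<omega> * u t) * cos (\<theta> t)) = - \<kappa> * (cos (\<theta> t) * q t)"
      by algebra
    moreover have "- sin (\<theta> t) * \<omega> * q t + - \<kappa> * p t * v t * cos (\<theta> t) =
        - \<kappa> * (sin (\<theta> t) * u t + cos (\<theta> t) * v t) * p t + 0 * (sin (\<theta> t) * q t)"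
      using qu by algebra
    moreover have "cos (\<theta> t) * \<omega> * q t + - \<kappa> * p t * v t * sin (\<theta> t) =
        \<kappa> * (cos (\<theta> t) * u t - sin (\<theta> t) * v t) * p t - 0 * (cos (\<theta> t) * q t)"
      using qu by algebra
    moreover have "- (\<kappa> * w t / 2) = \<kappa> * (cos (\<theta> t) * q t * (sin (\<theta> t) * u t + cos (\<theta> t) * v t) -
        sin (\<theta> t) * q t * (cos (\<theta> t) * u t - sin (\<theta> t) * v t))"
      unfolding qv[symmetric] using trig by algebra
    ultimately show ?thesis
      unfolding \<gamma> drift_field_def prod.case vector_2 vector_3 by (simp only:)
  qed
  show ?thesis
    unfolding field unfolding \<gamma>
    by (intro has_vector_derivative_Pair has_vector_derivative_vector_2 has_vector_derivative_vector_3
        DERIV_add DERIV_diff DERIV_mult cos' sin' u' v' q' p)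
qed

text \<open>
  The substitution \<open>p = m + d cos s\<close>, with midpoint \<open>m\<close> and half length \<open>d\<close> of \<open>[r\<^sub>1, r\<^sub>2]\<close>,
  removes the square root singularities at the turning points: the motion becomes
  \<open>s' = \<kappa> \<surd>(2 (r\<^sub>3 - p)) > 0\<close>, solvable by separation of variables, and one traversal is \<open>s\<close>
  running from \<open>0\<close> to \<open>2 \<pi>\<close>.
\<close>

lemma (in near_homoclinic) drift_traversal_exists:
  assumes "\<kappa> > 0"
  shows "\<exists>t0 t1 t2 \<gamma> \<theta>. drift_traversal \<kappa> 0 j h r1 r2 t0 t1 t2 \<gamma> \<theta>"
proof -
  define m where "m = (r1 + r2) / 2"
  define d where "d = (r2 - r1) / 2"
  have d: "d > 0"
    using order by (simp add: d_def)
  define P where "P s = m + d * cos s" for s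
  define g where "g s = \<kappa> * sqrt (2 * (r3 - P s))" for s
  have P_le: "P s \<le> r2" "r1 \<le> P s" for s
  proof -
    have "d * cos s \<le> d * 1" "d * (- 1) \<le> d * cos s"
      by (intro mult_left_mono; use d in simp)+
    moreover have "r1 = m - d" "r2 = m + d"
      by (simp_all add: m_def d_def field_simps)
    ultimately show "P s \<le> r2" "r1 \<le> P s"
      unfolding P_def by linarith+
  qed
  have P_less: "P s < r3" for s
    using P_le(1)[of s] order by linarith
  have g_pos: "g s > 0" for s
    using assms P_less[of s] by (simp add: g_def)
  have cont_g: "continuous_on A g" for A
    unfolding g_def[abs_def] P_def by (intro continuous_intros)
  \<comment> \<open>The interval \<open>[- 1, 7]\<close> contains \<open>[0, 2 \<pi>]\<close> in its interior.\<close>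
  obtain T S where T: "strict_mono_on {- 1..7} T" "continuous_on {- 1..7} T"
    and ST: "\<And>s. s \<in> {- 1..7} \<Longrightarrow> S (T s) = s"
    and S': "\<And>s. s \<in> {- 1<..<7} \<Longrightarrow> (S has_real_derivative g s) (at (T s))"
    using autonomous_flow[OF cont_g g_pos, of "- 1" 7] by metis
  have pi: "0 < pi" "2 * pi < 7"
    using pi_less_4 pi_gt_zero pi_approx by (auto simp: field_simps)
  have T_mono: "T a < T b" if "- 1 \<le> a" "a < b" "b \<le> 7" for a b
    using T(1) that by (auto simp: strict_mono_on_def)
  have onto: "\<exists>s\<in>{a..b}. t = T s" if "t \<in> {T a..T b}" "- 1 \<le> a" "a \<le> b" "b \<le> 7" for t a b
  proof -
    have "continuous_on {a..b} T"
      by (rule continuous_on_subset[OF T(2)]) (use that in auto)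
    thus ?thesis
      using IVT'[of T a t b] that by force
  qed
  define p where "p t = P (S t)" for t
  define w where "w t = sqrt 8 * (d * sin (S t)) * sqrt (r3 - P (S t))" for t
  let ?I = "{T 0..T (2 * pi)}"
  have S_deriv: "(S has_real_derivative g (S t)) (at t)" if t: "t \<in> ?I" for t
  proof -
    obtain s where "s \<in> {0..2 * pi}" "t = T s"
      using onto[OF t] pi by force
    thus ?thesis
      using S'[of s] ST[of s] pi by auto
  qed
  have sin_sq: "(d * sin s)\<^sup>2 = (P s - r1) * (r2 - P s)" for s
  proof -
    have "(d * sin s)\<^sup>2 = d\<^sup>2 - (d * cos s)\<^sup>2"
      by (simp add: power_mult_distrib sin_squared_eq algebra_simps)
    also have "d * cos s = P s - m"
      by (simp add: P_def)
    also have "d\<^sup>2 - (P s - m)\<^sup>2 = (P s - r1) * (r2 - P s)"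
      unfolding m_def d_def by (simp add: power2_eq_square field_simps)
    finally show ?thesis .
  qed
  have w_sq: "(w t)\<^sup>2 = 8 * (p t - r1) * (r2 - p t) * (r3 - p t)" for t
    using P_less[of "S t"]
    by (simp add: w_def p_def power_mult_distrib sin_sq[unfolded power_mult_distrib])
  have curve: "(w t)\<^sup>2 + h\<^sup>2 = 8 * (j - p t)\<^sup>2 * (j + p t)" for t
    using factorization[of "p t"] unfolding w_sq by algebra
  have p_bounds: "- j < p t" "p t < j" for t
    using P_le[of "S t"] r1_gt r2_less by (simp_all add: p_def)
  have p': "(p has_real_derivative - (\<kappa> * w t / 2)) (at t)" if "t \<in> ?I" for t
  proof -
    have "(p has_real_derivative d * (- sin (S t) * g (S t))) (at t)"
      unfolding p_def[abs_def] P_def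
      using S_deriv[OF that] by (auto intro!: derivative_eq_intros)
    moreover have "d * (- sin (S t) * g (S t)) = - (\<kappa> * w t / 2)"
    proof -
      have "sqrt 8 = 2 * sqrt 2"
        using real_sqrt_mult[of 4 2] by simp
      thus ?thesis
        unfolding g_def w_def real_sqrt_mult by simp
    qed
    ultimately show ?thesis
      by (simp only:)
  qed
  have w': "(w has_real_derivative
      - \<kappa> / 4 * (16 * (p t - j) * (p t + j) + 8 * (p t - j)\<^sup>2)) (at t)" if "t \<in> ?I" for t
  proof -
    define R where "R = sqrt (r3 - P (S t))"
    have R: "R > 0" "R\<^sup>2 = r3 - p t"
      using P_less[of "S t"] by (simp_all add: R_def p_def)
    have P': "((\<lambda>t. r3 - P (S t)) has_real_derivative d * sin (S t) * g (S t)) (at t)"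
      unfolding P_def using S_deriv[OF that] by (auto intro!: derivative_eq_intros)
    have "((\<lambda>t. sqrt (r3 - P (S t))) has_real_derivative
        inverse (sqrt (r3 - P (S t))) / 2 * (d * sin (S t) * g (S t))) (at t)"
      by (rule DERIV_chain2[where f = sqrt and x = t, OF DERIV_real_sqrt P']) (simp add: P_less)
    hence R': "((\<lambda>t. sqrt (r3 - P (S t))) has_real_derivative
        inverse R / 2 * (d * sin (S t) * g (S t))) (at t)"
      by (simp only: R_def)
    have sin': "((\<lambda>t. sqrt 8 * (d * sin (S t))) has_real_derivative
        sqrt 8 * (d * (cos (S t) * g (S t)))) (at t)"
      by (intro DERIV_cmult DERIV_chain2[OF DERIV_sin] S_deriv that)
    have "(w has_real_derivative
        sqrt 8 * (d * (cos (S t) * g (S t))) * sqrt (r3 - P (S t)) +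
        inverse R / 2 * (d * sin (S t) * g (S t)) * (sqrt 8 * (d * sin (S t)))) (at t)"
      unfolding w_def[abs_def] by (rule DERIV_mult[OF sin' R'])
    moreover have "sqrt 8 * (d * (cos (S t) * g (S t))) * sqrt (r3 - P (S t)) +
        inverse R / 2 * (d * sin (S t) * g (S t)) * (sqrt 8 * (d * sin (S t))) =
        4 * \<kappa> * (d * cos (S t) * R\<^sup>2 + (d * sin (S t))\<^sup>2 / 2)"
    proof -
      have "sqrt 8 * sqrt 2 = 4"
        by (simp flip: real_sqrt_mult)
      moreover have "g (S t) = \<kappa> * (sqrt 2 * R)"
        unfolding g_def R_def real_sqrt_mult ..
      ultimately show ?thesis
        unfolding R_def[symmetric] using R(1) by (simp add: field_simps power2_eq_square)
    qed
    moreover have "4 * \<kappa> * (d * cos (S t) * R\<^sup>2 + (d * sin (S t))\<^sup>2 / 2) =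
        - \<kappa> / 4 * (16 * (p t - j) * (p t + j) + 8 * (p t - j)\<^sup>2)"
    proof -
      have c: "d * cos (S t) = p t - (r1 + r2) / 2"
        by (simp add: p_def P_def m_def)
      have prods: "r1 * r2 + r1 * r3 + r2 * r3 = - (j\<^sup>2)"
        using factorization[of 0] factorization[of 1] factorization[of "-1"] by algebra
      have "4 * \<kappa> * ((p t - (r1 + r2) / 2) * (r3 - p t) + (p t - r1) * (r2 - p t) / 2) =
          - 2 * \<kappa> * (3 * (p t)\<^sup>2 - 2 * (r1 + r2 + r3) * p t + (r1 * r2 + r1 * r3 + r2 * r3))"
        by (simp add: field_simps power2_eq_square)
      also have "\<dots> = - \<kappa> / 4 * (16 * (p t - j) * (p t + j) + 8 * (p t - j)\<^sup>2)"
        unfolding prods root_sum by (simp add: field_simps power2_eq_square)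
      finally show ?thesis
        unfolding c R(2) sin_sq p_def[symmetric] .
    qed
    ultimately show ?thesis
      by (simp only:)
  qed
  have "continuous_on ?I p"
    using p' by (intro DERIV_continuous_on) (blast intro: has_field_derivative_at_within)
  moreover have "j\<^sup>2 - (p t)\<^sup>2 \<noteq> 0" for t
    using p_bounds[of t] by (auto simp: power2_eq_iff)
  ultimately have "continuous_on ?I (\<lambda>t. \<kappa> * h * p t / (2 * (j\<^sup>2 - (p t)\<^sup>2)))"
    by (intro continuous_intros) auto
  then obtain \<theta> where "\<And>t. t \<in> ?I \<Longrightarrow>
      (\<theta> has_vector_derivative \<kappa> * h * p t / (2 * (j\<^sup>2 - (p t)\<^sup>2))) (at t within ?I)"
    using antiderivative_continuous by blast
  hence \<theta>: "(\<theta> has_real_derivative \<kappa> * h * p t / (2 * (j\<^sup>2 - (p t)\<^sup>2))) (at t within ?I)"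
    if "t \<in> ?I" for t
    using that by (simp add: has_real_derivative_iff_has_vector_derivative)
  define \<gamma> where "\<gamma> t = rotate_state (\<theta> t) (lift j h (w t) (p t))" for t
  have invariants: "w1 (\<gamma> t) = w t" "w2 (\<gamma> t) = h" "pi3 (\<gamma> t) = p t" "\<gamma> t \<in> level_set j" for t
  proof -
    define q where "q = sqrt (j\<^sup>2 - (p t)\<^sup>2)"
    have "j\<^sup>2 - (p t)\<^sup>2 = (j - p t) * (j + p t)"
      by algebra
    hence q: "q > 0" "q\<^sup>2 = (j - p t) * (j + p t)"
      using p_bounds[of t] by (simp_all add: q_def)
    have \<gamma>: "\<gamma> t = (vector [cos (\<theta> t) * (h / (2 * q)) - sin (\<theta> t) * (- w t / (2 * q)),
                sin (\<theta> t) * (h / (2 * q)) + cos (\<theta> t) * (- w t / (2 * q))],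
        vector [cos (\<theta> t) * q, sin (\<theta> t) * q, p t])"
      by (simp add: \<gamma>_def rotated_lift Let_def q_def)
    have trig: "(sin (\<theta> t))\<^sup>2 + (cos (\<theta> t))\<^sup>2 = 1"
      by simp
    define u where "u = h / (2 * q)"
    define v where "v = - w t / (2 * q)"
    note \<gamma> = \<gamma>[folded u_def v_def]
    have uv: "2 * (u * q) = h" "2 * (v * q) = - w t"
      using q(1) by (simp_all add: u_def v_def)
    have "w1 (\<gamma> t) = - (2 * (v * q)) * ((sin (\<theta> t))\<^sup>2 + (cos (\<theta> t))\<^sup>2)"
      unfolding \<gamma> w1_def prod.case vector_2 vector_3 by algebra
    thus "w1 (\<gamma> t) = w t"
      unfolding trig uv by simp
    have "w2 (\<gamma> t) = 2 * (u * q) * ((sin (\<theta> t))\<^sup>2 + (cos (\<theta> t))\<^sup>2)"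
      unfolding \<gamma> w2_def prod.case vector_2 vector_3 by algebra
    thus "w2 (\<gamma> t) = h"
      unfolding trig uv by simp
    show "pi3 (\<gamma> t) = p t"
      by (simp add: \<gamma> pi3_def)
    have "4 * q\<^sup>2 * (u\<^sup>2 + v\<^sup>2) = (2 * (v * q))\<^sup>2 + (2 * (u * q))\<^sup>2"
      by algebra
    also have "\<dots> = (w t)\<^sup>2 + h\<^sup>2"
      unfolding uv by simp
    also have "\<dots> = 4 * q\<^sup>2 * (2 * (j - p t))"
      unfolding curve q(2) by algebra
    finally have uv2: "u\<^sup>2 + v\<^sup>2 = 2 * (j - p t)"
      using q(1) by simp
    have "(cos (\<theta> t) * u - sin (\<theta> t) * v)\<^sup>2 + (sin (\<theta> t) * u + cos (\<theta> t) * v)\<^sup>2 =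
        (u\<^sup>2 + v\<^sup>2) * ((sin (\<theta> t))\<^sup>2 + (cos (\<theta> t))\<^sup>2)"
      by algebra
    moreover have "(cos (\<theta> t) * q)\<^sup>2 + (sin (\<theta> t) * q)\<^sup>2 + (p t)\<^sup>2 =
        q\<^sup>2 * ((sin (\<theta> t))\<^sup>2 + (cos (\<theta> t))\<^sup>2) + (p t)\<^sup>2"
      by algebra
    moreover have "(j - p t) * (j + p t) + (p t)\<^sup>2 = j\<^sup>2"
      by algebra
    ultimately show "\<gamma> t \<in> level_set j"
      unfolding \<gamma> level_set_iff vector_2 vector_3 using j_pos by (simp add: trig uv2 q(2))
  qed
  have value_at: "p (T s) = P s" "w (T s) = sqrt 8 * (d * sin s) * sqrt (r3 - P s)"
    if "s \<in> {0..2 * pi}" for s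
    using ST[of s] that pi by (simp_all add: p_def w_def)
  have "drift_traversal \<kappa> 0 j h r1 r2 (T 0) (T pi) (T (2 * pi)) \<gamma> \<theta>"
    unfolding drift_traversal_def
  proof (intro conjI ballI)
    show "one_traversal r1 r2 (T 0) (T pi) (T (2 * pi)) (w1 \<circ> \<gamma>) (pi3 \<circ> \<gamma>)"
      unfolding one_traversal_def comp_def invariants
    proof (intro conjI ballI)
      show "T 0 < T pi" "T pi < T (2 * pi)"
        by (rule T_mono; use pi in linarith)+
      show "(w (T 0), p (T 0)) = (0, r2)" "(w (T pi), p (T pi)) = (0, r1)"
        "(w (T (2 * pi)), p (T (2 * pi))) = (0, r2)"
        using pi by (simp_all add: value_at P_def m_def d_def field_simps)
      show "0 < w t" if t: "t \<in> {T 0<..<T pi}" for t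
      proof -
        obtain s where s: "s \<in> {0..pi}" "t = T s"
          using onto[of t 0 pi] t pi by auto
        have "s \<noteq> 0" "s \<noteq> pi"
          using t s by auto
        hence "sin s > 0"
          using s by (intro sin_gt_zero) auto
        thus ?thesis
          using s d P_less[of s] value_at(2)[of s] by simp
      qed
      show "w t < 0" if t: "t \<in> {T pi<..<T (2 * pi)}" for t
      proof -
        obtain s where s: "s \<in> {pi..2 * pi}" "t = T s"
          using onto[of t pi "2 * pi"] t pi by auto
        have "s \<noteq> pi" "s \<noteq> 2 * pi"
          using t s by auto
        hence "sin s < 0"
          using s by (intro sin_lt_zero) auto
        hence "sqrt 8 * (d * sin s) * sqrt (r3 - P s) < 0"
          using d P_less[of s] by (intro mult_neg_pos mult_pos_neg) auto
        thus ?thesis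
          using s value_at(2)[of s] pi by simp
      qed
    qed
    show "\<gamma> t \<in> level_set j" "w2 (\<gamma> t) = h" for t
      by (rule invariants)+
    show "continuous_on ?I \<theta>"
      using \<theta> by (rule DERIV_continuous_on)
    show "(\<gamma> has_vector_derivative drift_field \<kappa> 0 (\<gamma> t)) (at t within ?I)" if "t \<in> ?I" for t
      unfolding \<gamma>_def
      by (intro lifted_motion p_bounds curve \<theta> that
          has_field_derivative_at_within[OF p'] has_field_derivative_at_within[OF w'])
    show "\<gamma> t = rotate_state (\<theta> t) (lift j h (w1 (\<gamma> t)) (pi3 (\<gamma> t)))" for t
      unfolding invariants by (simp add: \<gamma>_def)
  qed
  thus ?thesis
    by blast
qed

section \<open>The jump of the reconstruction phase\<close>

theorem mainTheorem8:
  fixes \<kappa> j1 :: real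
  assumes "\<kappa> > 0" and "j1 > 0"
  shows "\<exists>h0 > 0. \<exists>(r1 :: real \<Rightarrow> real) (r2 :: real \<Rightarrow> real) (r3 :: real \<Rightarrow> real) (\<phi> :: real \<Rightarrow> real).
    (\<forall>h. h \<noteq> 0 \<and> \<bar>h\<bar> < h0 \<longrightarrow>
       r1 h < r2 h \<and> r2 h < r3 h \<and>
       {p. 8 * (p - j1)\<^sup>2 * (p + j1) - h\<^sup>2 = 0} = {r1 h, r2 h, r3 h} \<and>
       {(w, p). (w, h, p) \<in> reduced_space j1} =
         {(w, p). w\<^sup>2 + h\<^sup>2 = 8 * (p\<^sup>2 - j1\<^sup>2) * (p - j1) \<and> r1 h \<le> p \<and> p \<le> r2 h} \<and>
       (\<exists>t0 t1 t2 \<gamma> \<theta>. drift_traversal \<kappa> 0 j1 h (r1 h) (r2 h) t0 t1 t2 \<gamma> \<theta>) \<and>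
       (\<forall>a t0 t1 t2 \<gamma> \<theta>. drift_traversal \<kappa> a j1 h (r1 h) (r2 h) t0 t1 t2 \<gamma> \<theta> \<longrightarrow>
          phase_traversal \<kappa> j1 h (r1 h) (r2 h) t0 t1 t2 (w1 \<circ> \<gamma>) (pi3 \<circ> \<gamma>) \<theta>) \<and>
       (\<forall>t0 t1 t2 w p \<theta>. phase_traversal \<kappa> j1 h (r1 h) (r2 h) t0 t1 t2 w p \<theta> \<longrightarrow>
          \<theta> t2 - \<theta> t0 = \<phi> h) \<and>
       phase_integrand j1 h (r1 h) (r2 h) (r3 h) absolutely_integrable_on {r1 h..r2 h} \<and>
       \<phi> h = -2 * integral {r1 h..r2 h} (phase_integrand j1 h (r1 h) (r2 h) (r3 h))) \<and>
    ((\<lambda>h. integral {r1 h..0} (phase_integrand j1 h (r1 h) (r2 h) (r3 h)))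
       \<longlongrightarrow> pi / 2) (at_right 0) \<and>
    ((\<lambda>h. integral {0..r2 h} (phase_integrand j1 h (r1 h) (r2 h) (r3 h)))
       \<longlongrightarrow> - (pi / 4)) (at_right 0) \<and>
    ((\<lambda>h. integral {r1 h..0} (phase_integrand j1 h (r1 h) (r2 h) (r3 h)))
       \<longlongrightarrow> - (pi / 2)) (at_left 0) \<and>
    ((\<lambda>h. integral {0..r2 h} (phase_integrand j1 h (r1 h) (r2 h) (r3 h)))
       \<longlongrightarrow> pi / 4) (at_left 0) \<and>
    (\<phi> \<longlongrightarrow> - (pi / 2)) (at_right 0) \<and>
    (\<phi> \<longlongrightarrow> pi / 2) (at_left 0) \<and>
    \<bar>Lim (at_right 0) \<phi> - Lim (at_left 0) \<phi>\<bar> = pi"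
proof -
  have "\<forall>y. \<exists>R. 0 < y \<and> y < 4 * j1 ^ 3 \<longrightarrow>
      - j1 < fst R \<and> fst R < - (3 * j1 / 4) \<and> 0 < fst (snd R) \<and> fst (snd R) < j1 \<and>
      j1 < snd (snd R) \<and> (\<forall>p. 8 * (p - j1)\<^sup>2 * (p + j1) - y =
        8 * (p - fst R) * (p - fst (snd R)) * (p - snd (snd R)))"
    using cubic_roots[OF assms(2)] by auto
  then obtain R where R: "\<And>y. 0 < y \<Longrightarrow> y < 4 * j1 ^ 3 \<Longrightarrow>
      - j1 < fst (R y) \<and> fst (R y) < - (3 * j1 / 4) \<and> 0 < fst (snd (R y)) \<and> fst (snd (R y)) < j1 \<and>
      j1 < snd (snd (R y)) \<and> (\<forall>p. 8 * (p - j1)\<^sup>2 * (p + j1) - y =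
        8 * (p - fst (R y)) * (p - fst (snd (R y))) * (p - snd (snd (R y))))"
    by metis
  \<comment> \<open>Chosen as functions of \<open>h\<^sup>2\<close>, the roots are even in \<open>h\<close>.\<close>
  define r1 where "r1 h = fst (R (h\<^sup>2))" for h
  define r2 where "r2 h = fst (snd (R (h\<^sup>2)))" for h
  define r3 where "r3 h = snd (snd (R (h\<^sup>2)))" for h
  define h0 where "h0 = sqrt (4 * j1 ^ 3)"
  have h0: "h0 > 0"
    using assms by (simp add: h0_def)
  have near: "near_homoclinic j1 h (r1 h) (r2 h) (r3 h)" if "h \<noteq> 0" "\<bar>h\<bar> < h0" for h
  proof -
    have "\<bar>h\<bar>\<^sup>2 < h0\<^sup>2"
      using that by (intro power_strict_mono) auto
    hence "0 < h\<^sup>2" "h\<^sup>2 < 4 * j1 ^ 3"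
      using that assms by (simp_all add: h0_def)
    from R[OF this] that assms show ?thesis
      unfolding near_homoclinic_def r1_def r2_def r3_def by blast
  qed
  have near_right: "\<forall>\<^sub>F h in at_right 0. near_homoclinic j1 h (r1 h) (r2 h) (r3 h)"
    using eventually_at_right_real[OF h0] by eventually_elim (auto intro: near)
  let ?G = "\<lambda>h. phase_integrand j1 h (r1 h) (r2 h) (r3 h)"
  define L where "L h = integral {r1 h..0} (?G h)" for h
  define N where "N h = integral {0..r2 h} (?G h)" for h
  define \<phi> where "\<phi> h = - 2 * integral {r1 h..r2 h} (?G h)" for h
  have even_r: "r1 (- h) = r1 h" "r2 (- h) = r2 h" "r3 (- h) = r3 h" for h
    by (simp_all add: r1_def r2_def r3_def)
  have odd_G: "phase_integrand j1 (- h) (r1 h) (r2 h) (r3 h) = (\<lambda>p. - ?G h p)" for h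
    by (simp add: fun_eq_iff phase_integrand_def)
  have odd: "L (- h) = - L h" "N (- h) = - N h" "\<phi> (- h) = - \<phi> h" for h
    unfolding L_def N_def \<phi>_def even_r odd_G by simp_all
  have left_from_right: "(f \<longlongrightarrow> - l) (at_left 0)"
    if "(f \<longlongrightarrow> l) (at_right 0)" "\<And>h. f (- h) = - f h" for f :: "real \<Rightarrow> real" and l
    using tendsto_minus[OF that(1)] that(2) by (simp add: filterlim_at_left_to_right)
  have L: "(L \<longlongrightarrow> pi / 2) (at_right 0)"
    unfolding L_def[abs_def] by (rule left_part_tendsto[OF assms(2) near_right])
  have N: "(N \<longlongrightarrow> - (pi / 4)) (at_right 0)"
    unfolding N_def[abs_def] by (rule right_part_tendsto[OF assms(2) near_right])
  have "((\<lambda>h. - 2 * (L h + N h)) \<longlongrightarrow> - 2 * (pi / 2 + - (pi / 4))) (at_right 0)"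
    by (intro tendsto_intros L N)
  moreover have "\<forall>\<^sub>F h in at_right 0. - 2 * (L h + N h) = \<phi> h"
    using near_right
    by eventually_elim (simp add: \<phi>_def L_def N_def near_homoclinic.integral_split)
  ultimately have "(\<phi> \<longlongrightarrow> - 2 * (pi / 2 + - (pi / 4))) (at_right 0)"
    by (rule Lim_transform_eventually)
  hence \<phi>: "(\<phi> \<longlongrightarrow> - (pi / 2)) (at_right 0)"
    by simp
  have L': "(L \<longlongrightarrow> - (pi / 2)) (at_left 0)"
    by (rule left_from_right[OF L odd(1)])
  have N': "(N \<longlongrightarrow> pi / 4) (at_left 0)"
    using left_from_right[OF N odd(2)] by simp
  have \<phi>': "(\<phi> \<longlongrightarrow> pi / 2) (at_left 0)"
    using left_from_right[OF \<phi> odd(3)] by simp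
  have jump: "\<bar>Lim (at_right 0) \<phi> - Lim (at_left 0) \<phi>\<bar> = pi"
    unfolding tendsto_Lim[OF trivial_limit_at_right_real \<phi>]
      tendsto_Lim[OF trivial_limit_at_left_real \<phi>']
    using pi_gt_zero by simp
  show ?thesis
  proof (rule exI[of _ h0], rule conjI[OF h0], rule exI[of _ r1], rule exI[of _ r2],
      rule exI[of _ r3], rule exI[of _ \<phi>], intro conjI allI impI)
    fix h assume "h \<noteq> 0 \<and> \<bar>h\<bar> < h0"
    then interpret near_homoclinic j1 h "r1 h" "r2 h" "r3 h"
      using near by blast
    show "r1 h < r2 h" "r2 h < r3 h"
      by (rule order)+
    show "{p. 8 * (p - j1)\<^sup>2 * (p + j1) - h\<^sup>2 = 0} = {r1 h, r2 h, r3 h}"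
      by (rule roots)
    show "{(w, p). (w, h, p) \<in> reduced_space j1} =
         {(w, p). w\<^sup>2 + h\<^sup>2 = 8 * (p\<^sup>2 - j1\<^sup>2) * (p - j1) \<and> r1 h \<le> p \<and> p \<le> r2 h}"
      unfolding reduced_curve ..
    show "\<exists>t0 t1 t2 \<gamma> \<theta>. drift_traversal \<kappa> 0 j1 h (r1 h) (r2 h) t0 t1 t2 \<gamma> \<theta>"
      by (rule drift_traversal_exists[OF assms(1)])
    show "?G h absolutely_integrable_on {r1 h..r2 h}"
      by (rule integrand_absolutely_integrable)
    show "\<phi> h = - 2 * integral {r1 h..r2 h} (?G h)"
      by (rule \<phi>_def)
    show "phase_traversal \<kappa> j1 h (r1 h) (r2 h) t0 t1 t2 (w1 \<circ> \<gamma>) (pi3 \<circ> \<gamma>) \<theta>"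
      if "drift_traversal \<kappa> a j1 h (r1 h) (r2 h) t0 t1 t2 \<gamma> \<theta>" for a t0 t1 t2 \<gamma> \<theta>
      using that by (rule drift_traversal_phase)
    show "\<theta> t2 - \<theta> t0 = \<phi> h"
      if "phase_traversal \<kappa> j1 h (r1 h) (r2 h) t0 t1 t2 w p \<theta>" for t0 t1 t2 w p \<theta>
      unfolding \<phi>_def using that by (rule phase_change)
  qed (use L N L' N' \<phi> \<phi>' jump in \<open>simp_all add: L_def[abs_def] N_def[abs_def]\<close>)
qed

end
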